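(* Let $\Gamma$ be a small category. For each $\Gamma$-stream $X$ (functor from $\Gamma$ to $\mathbf{DiTop}$), the objectwise directed singular cubical set $\mathrm{sing}\,X$ is a $\Gamma$-cubcat.
   Context: Cubical sets. For a natural number $k$, $[k]$ is the ordinal $\{0<1<\cdots<k\}$; posets are regarded as categories and $[k]^n$ is the product poset. $\square$ is the subcategory of the category of small categories with objects $[1]^n$ ($n\geq 0$) and morphisms all composites of cofaces $[1]^{n-1}\to[1]^n$ (inserting a constant $0$ or $1$ in one coordinate), codegeneracies $[1]^{n+1}\to[1]^n$ (projections omitting one coordinate) and coordinate permutations. Cubical sets are presheaves of sets on $\square$, forming the category $\hat\square$; $\square[1]^n$ is the presheaf represented by $[1]^n$. Streams. A circulation on a space $X$ assigns to each open $U\subset X$ a preorder $\leqslant_U$ on $U$ such that, for each collection $\mathcal{O}$ of open subsets, the preorder on $\bigcup\mathcal{O}$ is the one with smallest graph containing the graphs of all $\leqslant_U$, $U\in\mathcal{O}$. A stream is a space with a circulation; a stream map $f:X\to Y$ is a continuous function with $f(x)\leqslant_U f(y)$ whenever $U\subset Y$ is open and $x\leqslant_{f^{-1}U}y$. $\mathbf{DiTop}$ is the category of weak Hausdorff k-streams (k-stream: colimit of compact Hausdorff streams in all streams; weak Hausdorff: the underlying space is). $\vec{\mathbb{I}}^n$ is $[0,1]^n$ with the unique circulation whose value on the whole cube is the coordinatewise order. Directed realization $\|-\|:\hat\square\to\mathbf{DiTop}$ is the cocontinuous functor with $\|\square[1]^n\|=\vec{\mathbb{I}}^n$ (with the evident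 action on cofaces, codegeneracies, permutations); its right adjoint is $\mathrm{sing}$, $(\mathrm{sing}\,X)_n=\mathbf{DiTop}(\|\square[1]^n\|,X)$; $\mathbf{S}=\mathrm{sing}\,\|-\|$ is the resulting monad. $\Gamma$-cubical sets are functors $\Gamma\to\hat\square$ and $\Gamma$-cubical functions are natural transformations; functors on $\hat\square$ and $\mathbf{DiTop}$ are applied objectwise. Subdivision. A Boolean interval in a finite lattice is an interval (order-convex subset with a minimum and a maximum) isomorphic to some $[1]^m$. For a finite distributive lattice $L$, $\square[L]$ is the cubical set with $\square[L]_m$ the set of lattice homomorphisms $[1]^m\to L$ mapping Boolean intervals onto Boolean intervals. $\mathrm{sd}_2:\hat\square\to\hat\square$ is the cocontinuous functor with $\mathrm{sd}_2\square[1]^n=\square[[2]^n]$, where $[2]^n$ is identified with the poset $([1]^n)^{[1]}$ of monotone functions $[1]\to[1]^n$ (for $n=1$, $\zeta\mapsto\zeta(0)+\zeta(1)$) and $\square$-morphisms act by postcomposition. Its right adjoint is $\mathrm{ex}_2$, $(\mathrm{ex}_2C)_n=\hat\square(\mathrm{sd}_2\square[1]^n,C)$. There is a natural isomorphism $\varphi_{C;2}:\|\mathrm{sd}_2C\|\cong\|C\|$ that for $C=\square[1]^n$ is linear on cells and sends the vertex $v\in[2]^n$ to $v/2\in[0,1]^n$. Cubcats. $(-)^\sharp:\hat\square\to\hat\square$ is the cocontinuous functor with $(\square[1]^n)^\sharp=\mathbf{S}\square[1]^n$, and $\eta_C:C\to C^\sharp$ is the natural map given on representables by the unit of $\mathbf{S}$.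 $\varphi^\sharp_{C;2}:C^\sharp\to\mathrm{ex}_2C^\sharp$ is the natural map given for $C=\square[1]^n$ by sending an $m$-cube $\theta:\|\square[1]^m\|\to\|\square[1]^n\|$ to the $m$-cube of $\mathrm{ex}_2\mathbf{S}\square[1]^n$ adjoint to $\theta\varphi_{\square[1]^m;2}:\|\mathrm{sd}_2\square[1]^m\|\to\|\square[1]^n\|$. A $\Gamma$-cubcat is a $\Gamma$-cubical set $C$ for which there exist $\Gamma$-cubical functions $\rho:C^\sharp\to C$ and $\mu:\mathrm{ex}_2C\to C$ with $\rho\eta_C=\mathrm{id}_C$ and $\rho=\mu\circ(\mathrm{ex}_2\rho)\circ\varphi^\sharp_{C;2}$. *)

theory Defs
  imports "HOL-Analysis.Analysis" "HOL-Combinatorics.Permutations"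
begin

section \<open>The category of cubes\<close>

text \<open>
  Points of \<open>[k]\<^sup>n\<close> are functions on \<open>{..<n}\<close>, extensional in the sense of
  \<^const>\<open>PiE\<close>; the product order and the lattice operations on them are those of the
  type \<^typ>\<open>nat \<Rightarrow> nat\<close>.
\<close>

type_synonym vertex = "nat \<Rightarrow> nat"

definition grid :: "nat \<Rightarrow> nat \<Rightarrow> vertex set" where
  "grid k n = (\<Pi>\<^sub>E i\<in>{..<n}. {..k})"

definition coface :: "nat \<Rightarrow> nat \<Rightarrow> nat \<Rightarrow> vertex \<Rightarrow> vertex" where
  "coface n i e = (\<lambda>x\<in>grid 1 n. \<lambda>j\<in>{..<Suc n}.
     if j < i then x j else if j = i then e else x (j - 1))"

definition codegeneracy :: "nat \<Rightarrow> nat \<Rightarrow> vertex \<Rightarrow> vertex" where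
  "codegeneracy n i = (\<lambda>x\<in>grid 1 (Suc n). \<lambda>j\<in>{..<n}. if j < i then x j else x (Suc j))"

definition coordinate_permutation :: "nat \<Rightarrow> (nat \<Rightarrow> nat) \<Rightarrow> vertex \<Rightarrow> vertex" where
  "coordinate_permutation n p = (\<lambda>x\<in>grid 1 n. \<lambda>j\<in>{..<n}. x (p j))"

definition box_id :: "nat \<Rightarrow> vertex \<Rightarrow> vertex" where
  "box_id n = (\<lambda>x\<in>grid 1 n. x)"

text \<open>\<open>box m n f\<close>: \<open>f\<close> is a morphism \<open>[1]\<^sup>m \<rightarrow> [1]\<^sup>n\<close> of the cube category.\<close>

inductive box :: "nat \<Rightarrow> nat \<Rightarrow> (vertex \<Rightarrow> vertex) \<Rightarrow> bool" where
  box_ident: "box n n (box_id n)"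
| box_coface: "i \<le> n \<Longrightarrow> e \<in> {0, 1} \<Longrightarrow> box n (Suc n) (coface n i e)"
| box_codegeneracy: "i \<le> n \<Longrightarrow> box (Suc n) n (codegeneracy n i)"
| box_permutation: "p permutes {..<n} \<Longrightarrow> box n n (coordinate_permutation n p)"
| box_compose: "box l m g \<Longrightarrow> box m n f \<Longrightarrow> box l n (compose (grid 1 l) f g)"


section \<open>Cubical sets\<close>

text \<open>
  \<open>act C m n f\<close> is the action \<open>C\<^sub>n \<rightarrow> C\<^sub>m\<close> of a morphism \<open>f : [1]\<^sup>m \<rightarrow> [1]\<^sup>n\<close>.
\<close>

record 'c cset =
  cells :: "nat \<Rightarrow> 'c set"
  act :: "nat \<Rightarrow> nat \<Rightarrow> (vertex \<Rightarrow> vertex) \<Rightarrow> 'c \<Rightarrow> 'c"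

definition cubical_set :: "'c cset \<Rightarrow> bool" where
  "cubical_set C \<longleftrightarrow>
     (\<forall>m n f c. box m n f \<and> c \<in> cells C n \<longrightarrow> act C m n f c \<in> cells C m) \<and>
     (\<forall>n. \<forall>c\<in>cells C n. act C n n (box_id n) c = c) \<and>
     (\<forall>l m n g f c. box l m g \<and> box m n f \<and> c \<in> cells C n \<longrightarrow>
        act C l m g (act C m n f c) = act C l n (compose (grid 1 l) f g) c)"

definition cubical_map :: "'c cset \<Rightarrow> 'd cset \<Rightarrow> (nat \<Rightarrow> 'c \<Rightarrow> 'd) \<Rightarrow> bool" where
  "cubical_map C D F \<longleftrightarrow>
     (\<forall>n. \<forall>c\<in>cells C n. F n c \<in> cells D n) \<and>
     (\<forall>m n f c. box m n f \<and> c \<in> cells C n \<longrightarrow> F m (act C m n f c) = act D m n f (F n c))"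

text \<open>The extensional natural transformations, so that equality is equality on cells.\<close>

definition cubical_hom :: "'c cset \<Rightarrow> 'd cset \<Rightarrow> (nat \<Rightarrow> 'c \<Rightarrow> 'd) set" where
  "cubical_hom C D = {F. cubical_map C D F \<and> (\<forall>n. F n \<in> extensional (cells C n))}"


section \<open>Subdivision\<close>

definition boolean_interval :: "'a::lattice set \<Rightarrow> 'a set \<Rightarrow> bool" where
  "boolean_interval L B \<longleftrightarrow>
     (\<exists>a\<in>L. \<exists>b\<in>L. a \<le> b \<and> B = {x \<in> L. a \<le> x \<and> x \<le> b}) \<and>
     (\<exists>m h. bij_betw h (grid 1 m) B \<and> (\<forall>x\<in>grid 1 m. \<forall>y\<in>grid 1 m. x \<le> y \<longleftrightarrow> h x \<le> h y))"

text \<open>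
  \<open>\<box>[L]\<close> for a finite sublattice \<open>L\<close> of a distributive lattice.
\<close>

definition lattice_cset :: "'a::distrib_lattice set \<Rightarrow> (vertex \<Rightarrow> 'a) cset" where
  "lattice_cset L = \<lparr>
     cells = (\<lambda>m. {f \<in> grid 1 m \<rightarrow>\<^sub>E L.
        (\<forall>x\<in>grid 1 m. \<forall>y\<in>grid 1 m. f (inf x y) = inf (f x) (f y) \<and> f (sup x y) = sup (f x) (f y)) \<and>
        (\<forall>B. boolean_interval (grid 1 m) B \<longrightarrow> boolean_interval L (f ` B))}),
     act = (\<lambda>m n g f. compose (grid 1 m) f g)\<rparr>"

abbreviation sd2_cube :: "nat \<Rightarrow> (vertex \<Rightarrow> vertex) cset" where
  "sd2_cube n \<equiv> lattice_cset (grid 2 n)"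

text \<open>
  A point \<open>v\<close> of \<open>[2]\<^sup>n\<close> corresponds to the monotone function \<open>[1] \<rightarrow> [1]\<^sup>n\<close> with values
  \<open>v div 2\<close> at \<open>0\<close> and \<open>(v + 1) div 2\<close> at \<open>1\<close>, whose sum is \<open>v\<close>. Under this identification,
  \<open>sd2_map m n f : [2]\<^sup>m \<rightarrow> [2]\<^sup>n\<close> is postcomposition with \<open>f\<close>.
\<close>

definition sd2_map :: "nat \<Rightarrow> nat \<Rightarrow> (vertex \<Rightarrow> vertex) \<Rightarrow> vertex \<Rightarrow> vertex" where
  "sd2_map m n f = (\<lambda>v\<in>grid 2 m. \<lambda>j\<in>{..<n}.
     f (\<lambda>i\<in>{..<m}. v i div 2) j + f (\<lambda>i\<in>{..<m}. (v i + 1) div 2) j)"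

definition ex2 :: "'c cset \<Rightarrow> (nat \<Rightarrow> (vertex \<Rightarrow> vertex) \<Rightarrow> 'c) cset" where
  "ex2 C = \<lparr>
     cells = (\<lambda>n. cubical_hom (sd2_cube n) C),
     act = (\<lambda>m n f F k. \<lambda>a\<in>cells (sd2_cube m) k. F k (compose (grid 1 k) (sd2_map m n f) a))\<rparr>"

definition ex2_map ::
  "(nat \<Rightarrow> 'c \<Rightarrow> 'd) \<Rightarrow> nat \<Rightarrow> (nat \<Rightarrow> (vertex \<Rightarrow> vertex) \<Rightarrow> 'c) \<Rightarrow> nat \<Rightarrow> (vertex \<Rightarrow> vertex) \<Rightarrow> 'd" where
  "ex2_map G n F = (\<lambda>k. \<lambda>a\<in>cells (sd2_cube n) k. G k (F k a))"


section \<open>Streams\<close>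

record 'a stream =
  space_of :: "'a topology"
  circ :: "'a set \<Rightarrow> 'a rel"

abbreviation pts :: "'a stream \<Rightarrow> 'a set" where
  "pts X \<equiv> topspace (space_of X)"

text \<open>
  The preorder on \<open>\<Union>\<O>\<close> is the least one containing the given preorders; the case
  \<open>\<O> = {U}\<close> says that \<open>c U\<close> is a preorder on \<open>U\<close>. The value of \<open>c\<close> on sets that are not
  open is fixed to be empty.
\<close>

definition is_circulation :: "'a topology \<Rightarrow> ('a set \<Rightarrow> 'a rel) \<Rightarrow> bool" where
  "is_circulation T c \<longleftrightarrow>
     (\<forall>\<O>. (\<forall>U\<in>\<O>. openin T U) \<longrightarrow>
        preorder_on (\<Union>\<O>) (c (\<Union>\<O>)) \<and> (\<forall>U\<in>\<O>. c U \<subseteq> c (\<Union>\<O>)) \<and>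
        (\<forall>r. preorder_on (\<Union>\<O>) r \<and> (\<forall>U\<in>\<O>. c U \<subseteq> r) \<longrightarrow> c (\<Union>\<O>) \<subseteq> r)) \<and>
     (\<forall>U. \<not> openin T U \<longrightarrow> c U = {})"

definition stream :: "'a stream \<Rightarrow> bool" where
  "stream X \<longleftrightarrow> is_circulation (space_of X) (circ X)"

definition stream_map :: "'a stream \<Rightarrow> 'b stream \<Rightarrow> ('a \<Rightarrow> 'b) \<Rightarrow> bool" where
  "stream_map X Y f \<longleftrightarrow>
     continuous_map (space_of X) (space_of Y) f \<and>
     (\<forall>U x y. openin (space_of Y) U \<and> (x, y) \<in> circ X {z \<in> pts X. f z \<in> U} \<longrightarrow>
        (f x, f y) \<in> circ Y U)"

definition stream_hom :: "'a stream \<Rightarrow> 'b stream \<Rightarrow> ('a \<Rightarrow> 'b) set" where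
  "stream_hom X Y = {f \<in> extensional (pts X). stream_map X Y f}"

definition isomorphic_streams :: "'a stream \<Rightarrow> 'b stream \<Rightarrow> bool" where
  "isomorphic_streams X Y \<longleftrightarrow>
     (\<exists>f g. stream_map X Y f \<and> stream_map Y X g \<and>
        (\<forall>x\<in>pts X. g (f x) = x) \<and> (\<forall>y\<in>pts Y. f (g y) = y))"

text \<open>
  The test spaces \<open>K\<close> can be taken on the type \<^typ>\<open>'a set set\<close> without loss of generality:
  given \<open>g : K \<rightarrow> X\<close>, the closure in \<open>K\<close> of a set of representatives of the fibres of \<open>g\<close>
  is compact Hausdorff, has the same image, and has at most \<open>2^2^|'a|\<close> points.
\<close>

definition weak_Hausdorff :: "'a topology \<Rightarrow> bool" where
  "weak_Hausdorff T \<longleftrightarrow>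
     (\<forall>(K :: 'a set set topology) g.
        compact_space K \<and> Hausdorff_space K \<and> continuous_map K T g \<longrightarrow> closedin T (g ` topspace K))"


subsection \<open>Colimits of streams\<close>

text \<open>
  A diagram of streams consists of objects \<open>D i\<close> (\<open>i \<in> I\<close>) and arrows \<open>(i, j, f) \<in> A\<close>,
  where \<open>f : D i \<rightarrow> D j\<close>. For an equivalence relation \<open>E\<close> on the coproduct of the point sets,
  \<open>glue I D E\<close> is the quotient with the final topology and the final circulation: its preorder on
  an open set \<open>U\<close> is generated by the images of the preorders on the preimages of \<open>U\<close>.
\<close>

definition coproduct_pts :: "'i set \<Rightarrow> ('i \<Rightarrow> 'k stream) \<Rightarrow> ('i \<times> 'k) set" where
  "coproduct_pts I D = (SIGMA i:I. pts (D i))"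

definition glue :: "'i set \<Rightarrow> ('i \<Rightarrow> 'k stream) \<Rightarrow> ('i \<times> 'k) rel \<Rightarrow> ('i \<times> 'k) set stream" where
  "glue I D E =
     (let opn = (\<lambda>U. U \<subseteq> coproduct_pts I D // E \<and>
            (\<forall>i\<in>I. openin (space_of (D i)) {x \<in> pts (D i). E `` {(i, x)} \<in> U}))
      in \<lparr>space_of = topology opn,
          circ = (\<lambda>U. if opn U
            then (\<Union>i\<in>I. {(E `` {(i, x)}, E `` {(i, y)}) | x y.
                    (x, y) \<in> circ (D i) {z \<in> pts (D i). E `` {(i, z)} \<in> U}})\<^sup>+
            else {})\<rparr>)"

definition arrow_rel ::
  "('i \<Rightarrow> 'k stream) \<Rightarrow> ('i \<times> 'i \<times> ('k \<Rightarrow> 'k)) set \<Rightarrow> ('i \<times> 'k) rel" where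
  "arrow_rel D A = {((i, x), (j, f x)) | i j f x. (i, j, f) \<in> A \<and> x \<in> pts (D i)}"

definition stream_colimit ::
  "'i set \<Rightarrow> ('i \<Rightarrow> 'k stream) \<Rightarrow> ('i \<times> 'i \<times> ('k \<Rightarrow> 'k)) set \<Rightarrow> ('i \<times> 'k) set stream" where
  "stream_colimit I D A = glue I D (\<Inter>{E. equiv (coproduct_pts I D) E \<and> arrow_rel D A \<subseteq> E})"

text \<open>
  The colimit in \<open>DiTop\<close> of a diagram in \<open>DiTop\<close> is the weak Hausdorff reflection of its colimit
  in all streams, i.e. the quotient by the least equivalence relation for which it is weak
  Hausdorff.
\<close>

definition ditop_rel ::
  "'i set \<Rightarrow> ('i \<Rightarrow> 'k stream) \<Rightarrow> ('i \<times> 'i \<times> ('k \<Rightarrow> 'k)) set \<Rightarrow> ('i \<times> 'k) rel" where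
  "ditop_rel I D A = \<Inter>{E. equiv (coproduct_pts I D) E \<and> arrow_rel D A \<subseteq> E \<and>
     weak_Hausdorff (space_of (glue I D E))}"

definition ditop_colimit ::
  "'i set \<Rightarrow> ('i \<Rightarrow> 'k stream) \<Rightarrow> ('i \<times> 'i \<times> ('k \<Rightarrow> 'k)) set \<Rightarrow> ('i \<times> 'k) set stream" where
  "ditop_colimit I D A = glue I D (ditop_rel I D A)"

text \<open>
  A k-stream is a colimit of compact Hausdorff streams. For weak Hausdorff \<open>X\<close>, the only
  case used below, the types bounding the size of the diagram are no restriction: the image of a
  compact Hausdorff stream in \<open>X\<close> is compact Hausdorff, so if \<open>X\<close> is such a colimit then it
  is the colimit of the diagram of all compact Hausdorff streams on subsets of \<open>X\<close> equipped
  with a stream map to \<open>X\<close>.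
\<close>

definition k_stream :: "'a stream \<Rightarrow> bool" where
  "k_stream X \<longleftrightarrow> stream X \<and>
     (\<exists>(I :: ('a stream \<times> ('a \<Rightarrow> 'a)) set) (D :: 'a stream \<times> ('a \<Rightarrow> 'a) \<Rightarrow> 'a stream) A.
        (\<forall>i\<in>I. stream (D i) \<and> compact_space (space_of (D i)) \<and> Hausdorff_space (space_of (D i))) \<and>
        (\<forall>(i, j, f)\<in>A. i \<in> I \<and> j \<in> I \<and> f \<in> stream_hom (D i) (D j)) \<and>
        isomorphic_streams X (stream_colimit I D A))"

definition ditop :: "'a stream \<Rightarrow> bool" where
  "ditop X \<longleftrightarrow> k_stream X \<and> weak_Hausdorff (space_of X)"


section \<open>Directed realization\<close>

type_synonym point = "nat \<Rightarrow> real"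

definition cube_topology :: "nat \<Rightarrow> point topology" where
  "cube_topology n = product_topology (\<lambda>i. top_of_set {0..1}) {..<n}"

text \<open>The directed cube, which is also \<open>\<parallel>\<box>[1]\<^sup>n\<parallel>\<close>.\<close>

definition dcube :: "nat \<Rightarrow> point stream" where
  "dcube n = \<lparr>
     space_of = cube_topology n,
     circ = (THE c. is_circulation (cube_topology n) c \<and>
        c (topspace (cube_topology n)) =
          {(x, y). x \<in> topspace (cube_topology n) \<and> y \<in> topspace (cube_topology n) \<and> x \<le> y})\<rparr>"

text \<open>The affine map \<open>[0,1]\<^sup>m \<rightarrow> \<real>\<^sup>n\<close> with the same values as \<open>g\<close> at the origin and the unit vectors.\<close>

definition affine_ext :: "nat \<Rightarrow> nat \<Rightarrow> (vertex \<Rightarrow> nat \<Rightarrow> real) \<Rightarrow> point \<Rightarrow> point" where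
  "affine_ext m n g = (\<lambda>t\<in>pts (dcube m). \<lambda>j\<in>{..<n}.
     g (\<lambda>l\<in>{..<m}. 0) j +
     (\<Sum>i<m. t i * (g (\<lambda>l\<in>{..<m}. if l = i then 1 else 0) j - g (\<lambda>l\<in>{..<m}. 0) j)))"

text \<open>
  In every morphism of the cube category each output coordinate is constant or an input
  coordinate, so its realization is its affine extension.
\<close>

definition box_real :: "nat \<Rightarrow> nat \<Rightarrow> (vertex \<Rightarrow> vertex) \<Rightarrow> point \<Rightarrow> point" where
  "box_real m n f = affine_ext m n (\<lambda>v j. real (f v j))"

text \<open>\<open>\<parallel>C\<parallel>\<close> is the colimit in \<open>DiTop\<close> of directed cubes over the category of elements of \<open>C\<close>.\<close>

definition elements :: "'c cset \<Rightarrow> (nat \<times> 'c) set" where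
  "elements C = (SIGMA n:UNIV. cells C n)"

definition element_arrows :: "'c cset \<Rightarrow> ((nat \<times> 'c) \<times> (nat \<times> 'c) \<times> (point \<Rightarrow> point)) set" where
  "element_arrows C = {((m, act C m n f c), (n, c), box_real m n f) | m n f c.
     box m n f \<and> c \<in> cells C n}"

definition realization :: "'c cset \<Rightarrow> ((nat \<times> 'c) \<times> point) set stream" where
  "realization C = ditop_colimit (elements C) (\<lambda>(n, c). dcube n) (element_arrows C)"

text \<open>\<open>cell_map C n c\<close> is the map \<open>\<parallel>\<box>[1]\<^sup>n\<parallel> \<rightarrow> \<parallel>C\<parallel>\<close> induced by the cell \<open>c\<close>.\<close>

definition cell_map :: "'c cset \<Rightarrow> nat \<Rightarrow> 'c \<Rightarrow> point \<Rightarrow> ((nat \<times> 'c) \<times> point) set" where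
  "cell_map C n c = (\<lambda>t\<in>pts (dcube n).
     ditop_rel (elements C) (\<lambda>(n, c). dcube n) (element_arrows C) `` {((n, c), t)})"

definition sing :: "'a stream \<Rightarrow> (point \<Rightarrow> 'a) cset" where
  "sing X = \<lparr>
     cells = (\<lambda>n. stream_hom (dcube n) X),
     act = (\<lambda>m n f h. compose (pts (dcube m)) h (box_real m n f))\<rparr>"

definition sing_map :: "('a \<Rightarrow> 'b) \<Rightarrow> nat \<Rightarrow> (point \<Rightarrow> 'a) \<Rightarrow> point \<Rightarrow> 'b" where
  "sing_map g n h = compose (pts (dcube n)) g h"

text \<open>The cubical map \<open>C \<rightarrow> sing X\<close> adjoint to a stream map \<open>h : \<parallel>C\<parallel> \<rightarrow> X\<close>.\<close>

definition adjunct ::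
  "'c cset \<Rightarrow> (((nat \<times> 'c) \<times> point) set \<Rightarrow> 'a) \<Rightarrow> nat \<Rightarrow> 'c \<Rightarrow> point \<Rightarrow> 'a" where
  "adjunct C h = (\<lambda>n. \<lambda>c\<in>cells C n. compose (pts (dcube n)) h (cell_map C n c))"

text \<open>
  The natural isomorphism \<open>\<parallel>sd\<^sub>2 C\<parallel> \<cong> \<parallel>C\<parallel>\<close> for \<open>C = \<box>[1]\<^sup>n\<close>. A point of \<open>\<parallel>sd\<^sub>2 \<box>[1]\<^sup>n\<parallel>\<close> is a class
  of points \<open>t\<close> in cells \<open>a : [1]\<^sup>k \<rightarrow> [2]\<^sup>n\<close>, and each cell is mapped affinely with vertices
  \<open>v\<close> going to \<open>a v / 2\<close>.
\<close>

definition phi2 :: "nat \<Rightarrow> ((nat \<times> (vertex \<Rightarrow> vertex)) \<times> point) set \<Rightarrow> point" where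
  "phi2 n = (\<lambda>P\<in>pts (realization (sd2_cube n)).
     the_elem ((\<lambda>((k, a), t). affine_ext k n (\<lambda>v j. real (a v j) / 2) t) ` P))"


section \<open>The functor sharp\<close>

text \<open>
  As the cocontinuous functor taking \<open>\<box>[1]\<^sup>n\<close> to \<open>\<S>\<box>[1]\<^sup>n = sing (dcube n)\<close>, the functor sharp is given by the
  coend formula: an \<open>m\<close>-cell of \<open>C\<^sup>\<sharp>\<close> is the class of a triple \<open>(n, c, h)\<close> with \<open>c \<in> C\<^sub>n\<close>
  and \<open>h\<close> an \<open>m\<close>-cell of \<open>\<S>\<box>[1]\<^sup>n\<close>, which stands for the image of \<open>h\<close> under
  \<open>c\<^sup>\<sharp> : \<S>\<box>[1]\<^sup>n \<rightarrow> C\<^sup>\<sharp>\<close>. Functions out of \<open>C\<^sup>\<sharp>\<close> are defined on representatives.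
\<close>

definition sharp_triples :: "'c cset \<Rightarrow> nat \<Rightarrow> (nat \<times> 'c \<times> (point \<Rightarrow> point)) set" where
  "sharp_triples C m = {(n, c, h). c \<in> cells C n \<and> h \<in> cells (sing (dcube n)) m}"

definition sharp_rel :: "'c cset \<Rightarrow> nat \<Rightarrow> (nat \<times> 'c \<times> (point \<Rightarrow> point)) rel" where
  "sharp_rel C m = \<Inter>{E. equiv (sharp_triples C m) E \<and>
     {((k, act C k n f c, h), (n, c, sing_map (box_real k n f) m h)) | k n f c h.
        box k n f \<and> c \<in> cells C n \<and> h \<in> cells (sing (dcube k)) m} \<subseteq> E}"

definition sharp_class ::
  "'c cset \<Rightarrow> nat \<Rightarrow> nat \<times> 'c \<times> (point \<Rightarrow> point) \<Rightarrow> (nat \<times> 'c \<times> (point \<Rightarrow> point)) set" where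
  "sharp_class C m p = sharp_rel C m `` {p}"

definition sharp :: "'c cset \<Rightarrow> (nat \<times> 'c \<times> (point \<Rightarrow> point)) set cset" where
  "sharp C = \<lparr>
     cells = (\<lambda>m. sharp_triples C m // sharp_rel C m),
     act = (\<lambda>l m f P. the_elem
        ((\<lambda>(n, c, h). sharp_class C l (n, c, act (sing (dcube n)) l m f h)) ` P))\<rparr>"

definition sharp_map ::
  "'d cset \<Rightarrow> (nat \<Rightarrow> 'c \<Rightarrow> 'd) \<Rightarrow> nat \<Rightarrow> (nat \<times> 'c \<times> (point \<Rightarrow> point)) set
     \<Rightarrow> (nat \<times> 'd \<times> (point \<Rightarrow> point)) set" where
  "sharp_map D F m P = the_elem ((\<lambda>(n, c, h). sharp_class D m (n, F n c, h)) ` P)"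

text \<open>
  The unit \<open>\<box>[1]\<^sup>n \<rightarrow> \<S>\<box>[1]\<^sup>n\<close> sends \<open>f\<close> to its realization, and \<open>c \<in> C\<^sub>n\<close> is the image of
  the identity of \<open>[1]\<^sup>n\<close> under the map \<open>\<box>[1]\<^sup>n \<rightarrow> C\<close> it represents.
\<close>

definition eta :: "'c cset \<Rightarrow> nat \<Rightarrow> 'c \<Rightarrow> (nat \<times> 'c \<times> (point \<Rightarrow> point)) set" where
  "eta C n c = sharp_class C n (n, c, box_real n n (box_id n))"

text \<open>
  On \<open>\<box>[1]\<^sup>n\<close>: the \<open>m\<close>-cell of \<open>ex\<^sub>2 \<S>\<box>[1]\<^sup>n\<close> adjoint to the composite of
  \<open>h : \<parallel>\<box>[1]\<^sup>m\<parallel> \<rightarrow> \<parallel>\<box>[1]\<^sup>n\<parallel>\<close> with \<open>phi2 m\<close>. In general: \<open>ex\<^sub>2 (c\<^sup>\<sharp>)\<close> applied to that cell.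
\<close>

definition phi_sharp_cube ::
  "nat \<Rightarrow> (point \<Rightarrow> point) \<Rightarrow> nat \<Rightarrow> (vertex \<Rightarrow> vertex) \<Rightarrow> point \<Rightarrow> point" where
  "phi_sharp_cube m h =
     adjunct (sd2_cube m) (compose (pts (realization (sd2_cube m))) h (phi2 m))"

definition phi_sharp ::
  "'c cset \<Rightarrow> nat \<Rightarrow> (nat \<times> 'c \<times> (point \<Rightarrow> point)) set
     \<Rightarrow> nat \<Rightarrow> (vertex \<Rightarrow> vertex) \<Rightarrow> (nat \<times> 'c \<times> (point \<Rightarrow> point)) set" where
  "phi_sharp C m P = the_elem
     ((\<lambda>(n, c, h). ex2_map (\<lambda>k s. sharp_class C k (n, c, s)) m (phi_sharp_cube m h)) ` P)"


section \<open>Diagrams and cubcats\<close>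

record ('o, 'm) cat =
  Obj :: "'o set"
  Arr :: "'m set"
  Dom :: "'m \<Rightarrow> 'o"
  Cod :: "'m \<Rightarrow> 'o"
  Idn :: "'o \<Rightarrow> 'm"
  Cmp :: "'m \<Rightarrow> 'm \<Rightarrow> 'm"

definition category :: "('o, 'm) cat \<Rightarrow> bool" where
  "category \<Gamma> \<longleftrightarrow>
     (\<forall>f\<in>Arr \<Gamma>. Dom \<Gamma> f \<in> Obj \<Gamma> \<and> Cod \<Gamma> f \<in> Obj \<Gamma>) \<and>
     (\<forall>a\<in>Obj \<Gamma>. Idn \<Gamma> a \<in> Arr \<Gamma> \<and> Dom \<Gamma> (Idn \<Gamma> a) = a \<and> Cod \<Gamma> (Idn \<Gamma> a) = a) \<and>
     (\<forall>g\<in>Arr \<Gamma>. \<forall>f\<in>Arr \<Gamma>. Cod \<Gamma> f = Dom \<Gamma> g \<longrightarrow>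
        Cmp \<Gamma> g f \<in> Arr \<Gamma> \<and> Dom \<Gamma> (Cmp \<Gamma> g f) = Dom \<Gamma> f \<and> Cod \<Gamma> (Cmp \<Gamma> g f) = Cod \<Gamma> g) \<and>
     (\<forall>f\<in>Arr \<Gamma>. Cmp \<Gamma> f (Idn \<Gamma> (Dom \<Gamma> f)) = f \<and> Cmp \<Gamma> (Idn \<Gamma> (Cod \<Gamma> f)) f = f) \<and>
     (\<forall>h\<in>Arr \<Gamma>. \<forall>g\<in>Arr \<Gamma>. \<forall>f\<in>Arr \<Gamma>. Cod \<Gamma> f = Dom \<Gamma> g \<and> Cod \<Gamma> g = Dom \<Gamma> h \<longrightarrow>
        Cmp \<Gamma> h (Cmp \<Gamma> g f) = Cmp \<Gamma> (Cmp \<Gamma> h g) f)"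

record ('o, 'm, 'x, 'h) diagram =
  ob :: "'o \<Rightarrow> 'x"
  ar :: "'m \<Rightarrow> 'h"

type_synonym ('o, 'm, 'a) stream_diagram = "('o, 'm, 'a stream, 'a \<Rightarrow> 'a) diagram"
type_synonym ('o, 'm, 'c) cset_diagram = "('o, 'm, 'c cset, nat \<Rightarrow> 'c \<Rightarrow> 'c) diagram"

definition gamma_stream :: "('o, 'm) cat \<Rightarrow> ('o, 'm, 'a) stream_diagram \<Rightarrow> bool" where
  "gamma_stream \<Gamma> X \<longleftrightarrow>
     (\<forall>a\<in>Obj \<Gamma>. ditop (ob X a)) \<and>
     (\<forall>f\<in>Arr \<Gamma>. ar X f \<in> stream_hom (ob X (Dom \<Gamma> f)) (ob X (Cod \<Gamma> f))) \<and>
     (\<forall>a\<in>Obj \<Gamma>. \<forall>x\<in>pts (ob X a). ar X (Idn \<Gamma> a) x = x) \<and>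
     (\<forall>g\<in>Arr \<Gamma>. \<forall>f\<in>Arr \<Gamma>. Cod \<Gamma> f = Dom \<Gamma> g \<longrightarrow>
        (\<forall>x\<in>pts (ob X (Dom \<Gamma> f)). ar X (Cmp \<Gamma> g f) x = ar X g (ar X f x)))"

definition gamma_cubical_set :: "('o, 'm) cat \<Rightarrow> ('o, 'm, 'c) cset_diagram \<Rightarrow> bool" where
  "gamma_cubical_set \<Gamma> C \<longleftrightarrow>
     (\<forall>a\<in>Obj \<Gamma>. cubical_set (ob C a)) \<and>
     (\<forall>f\<in>Arr \<Gamma>. cubical_map (ob C (Dom \<Gamma> f)) (ob C (Cod \<Gamma> f)) (ar C f)) \<and>
     (\<forall>a\<in>Obj \<Gamma>. \<forall>n. \<forall>c\<in>cells (ob C a) n. ar C (Idn \<Gamma> a) n c = c) \<and>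
     (\<forall>g\<in>Arr \<Gamma>. \<forall>f\<in>Arr \<Gamma>. Cod \<Gamma> f = Dom \<Gamma> g \<longrightarrow>
        (\<forall>n. \<forall>c\<in>cells (ob C (Dom \<Gamma> f)) n. ar C (Cmp \<Gamma> g f) n c = ar C g n (ar C f n c)))"

definition gamma_cubical_map ::
  "('o, 'm) cat \<Rightarrow> ('o, 'm, 'c) cset_diagram \<Rightarrow> ('o, 'm, 'd) cset_diagram
     \<Rightarrow> ('o \<Rightarrow> nat \<Rightarrow> 'c \<Rightarrow> 'd) \<Rightarrow> bool" where
  "gamma_cubical_map \<Gamma> C D F \<longleftrightarrow>
     (\<forall>a\<in>Obj \<Gamma>. cubical_map (ob C a) (ob D a) (F a)) \<and>
     (\<forall>f\<in>Arr \<Gamma>. \<forall>n. \<forall>c\<in>cells (ob C (Dom \<Gamma> f)) n.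
        F (Cod \<Gamma> f) n (ar C f n c) = ar D f n (F (Dom \<Gamma> f) n c))"

definition gamma_sing :: "('o, 'm, 'a) stream_diagram \<Rightarrow> ('o, 'm, point \<Rightarrow> 'a) cset_diagram" where
  "gamma_sing X = \<lparr>ob = (\<lambda>a. sing (ob X a)), ar = (\<lambda>f. sing_map (ar X f))\<rparr>"

definition gamma_ex2 ::
  "('o, 'm, 'c) cset_diagram \<Rightarrow> ('o, 'm, nat \<Rightarrow> (vertex \<Rightarrow> vertex) \<Rightarrow> 'c) cset_diagram" where
  "gamma_ex2 C = \<lparr>ob = (\<lambda>a. ex2 (ob C a)), ar = (\<lambda>f. ex2_map (ar C f))\<rparr>"

definition gamma_sharp ::
  "('o, 'm) cat \<Rightarrow> ('o, 'm, 'c) cset_diagram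
     \<Rightarrow> ('o, 'm, (nat \<times> 'c \<times> (point \<Rightarrow> point)) set) cset_diagram" where
  "gamma_sharp \<Gamma> C = \<lparr>ob = (\<lambda>a. sharp (ob C a)),
     ar = (\<lambda>f. sharp_map (ob C (Cod \<Gamma> f)) (ar C f))\<rparr>"

definition gamma_cubcat :: "('o, 'm) cat \<Rightarrow> ('o, 'm, 'c) cset_diagram \<Rightarrow> bool" where
  "gamma_cubcat \<Gamma> C \<longleftrightarrow> gamma_cubical_set \<Gamma> C \<and>
     (\<exists>\<rho> \<mu>. gamma_cubical_map \<Gamma> (gamma_sharp \<Gamma> C) C \<rho> \<and>
        gamma_cubical_map \<Gamma> (gamma_ex2 C) C \<mu> \<and>
        (\<forall>a\<in>Obj \<Gamma>. \<forall>n. \<forall>c\<in>cells (ob C a) n. \<rho> a n (eta (ob C a) n c) = c) \<and>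
        (\<forall>a\<in>Obj \<Gamma>. \<forall>n. \<forall>s\<in>cells (sharp (ob C a)) n.
           \<rho> a n s = \<mu> a n (ex2_map (\<rho> a) n (phi_sharp (ob C a) n s))))"

end

theory Submission
  imports Defs
begin

text \<open>
  A singular cube \<open>c : \<parallel>\<box>[1]\<^sup>n\<parallel> \<rightarrow> X\<close> acts on \<open>h : \<parallel>\<box>[1]\<^sup>m\<parallel> \<rightarrow> \<parallel>\<box>[1]\<^sup>n\<parallel>\<close> by composition, which gives \<open>\<rho>\<close>.
  A cubical function \<open>sd\<^sub>2 \<box>[1]\<^sup>n \<rightarrow> sing X\<close> is a compatible family of singular cubes on the \<open>2\<^sup>n\<close>
  subcubes of \<open>[0,1]\<^sup>n\<close> (and their faces), and \<open>\<mu>\<close> glues them: this is precomposition of the adjoint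
  map with the inverse of \<open>\<phi>\<close>. The glued map is a stream map because the circulation of the
  directed cube is explicit: its preorder on an open set \<open>U\<close> is generated by the pairs \<open>x \<le> y\<close> whose whole
  order interval lies in \<open>U\<close>.
\<close>

section \<open>The circulation of the directed cube\<close>

text \<open>The subcubes are closed, whereas a circulation is determined by open covers. Continuity
  therefore pastes along the subcubes, but the preorders do not paste formally. This is what the
  explicit generators are for: a step \<open>x \<le> y\<close> with
  \<open>{x..y} \<subseteq> U\<close> can be cut into two steps, each inside a single subcube,
  without leaving \<open>U\<close>. The description by generators has to be earned, because
  \<open>dcube\<close> selects its circulation by a definite description; both existence and
  uniqueness must be shown. The second obstacle is that the realization and the functor sharp are
  quotients by intersections of equivalence relations. A function on representatives is shown to be
  constant on classes by exhibiting its kernel as one of the intersected relations; for the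
  realization this kernel must also have a weak Hausdorff quotient, which the Hausdorff cube
  supplies. The inverse of \<phi> is written chart by chart: a point \<open>t\<close> of the subcube
  with least vertex \<open>w / 2\<close> is read in the cell \<open>x + w\<close> at the coordinates
  \<open>2 t - w\<close>.\<close>

lemma topspace_cube: "topspace (cube_topology n) = {..<n} \<rightarrow>\<^sub>E {0..1}"
  by (simp add: cube_topology_def)

lemma pts_dcube: "pts (dcube n) = {..<n} \<rightarrow>\<^sub>E {0..1}"
  by (simp add: dcube_def topspace_cube)

lemma space_of_dcube: "space_of (dcube n) = cube_topology n"
  by (simp add: dcube_def)

text \<open>Outside \<open>I\<close> both endpoints take the value \<open>undefined\<close>, so
  antisymmetry forces \<open>z\<close> to take it as well. This is why the interval
  \<open>{x..y}\<close> of the whole function type can stand for the interval in the cube.\<close>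

lemma PiE_order_convex:
  fixes x y z :: point
  assumes "x \<in> PiE I A" "y \<in> PiE I A" "x \<le> z" "z \<le> y"
    and "\<And>i. i \<in> I \<Longrightarrow> {x i..y i} \<subseteq> A i"
  shows "z \<in> PiE I A"
proof (rule PiE_I)
  show "z i \<in> A i" if "i \<in> I" for i
    using assms that by (force simp: le_fun_def)
  show "z i = undefined" if "i \<notin> I" for i
    using assms that PiE_arb[OF assms(1) that] PiE_arb[OF assms(2) that]
    by (metis le_funD order_antisym)
qed

text \<open>Products of relatively open intervals form a basis, and such products are order-convex.
  On a convex set every comparable pair is a generating step.\<close>

lemma convex_neighbourhood:
  assumes "openin (cube_topology n) U" "p \<in> U"
  obtains B where "openin (cube_topology n) B" "p \<in> B" "B \<subseteq> U"
    "\<And>x y. x \<in> B \<Longrightarrow> y \<in> B \<Longrightarrow> {x..y} \<subseteq> B"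
proof -
  obtain V where V: "\<And>i. i < n \<Longrightarrow> openin (top_of_set {0..1::real}) (V i)"
    "p \<in> PiE {..<n} V" "PiE {..<n} V \<subseteq> U"
    using assms(1)[unfolded cube_topology_def openin_product_topology_alt, rule_format, OF assms(2)] by auto
  have "\<exists>e>0. {0..1} \<inter> ball (p i) e \<subseteq> V i" if i: "i < n" for i
  proof -
    obtain T where T: "open T" "V i = {0..1} \<inter> T"
      using V(1)[OF i] by (auto simp: openin_open)
    have "p i \<in> V i"
      using V(2) i by auto
    then obtain e where "e > 0" "ball (p i) e \<subseteq> T"
      using T open_contains_ball[of T] by auto
    then show ?thesis
      using T(2) by auto
  qed
  then obtain e where e: "\<And>i. i < n \<Longrightarrow> e i > 0" "\<And>i. i < n \<Longrightarrow> {0..1} \<inter> ball (p i) (e i) \<subseteq> V i"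
    by metis
  define B where "B = (\<Pi>\<^sub>E i\<in>{..<n}. {0..1} \<inter> ball (p i) (e i))"
  have "V i \<subseteq> {0..1}" if "i < n" for i
    using openin_subset[OF V(1)[OF that]] by simp
  then have "p \<in> B"
    using V(2) e(1) unfolding B_def by (force simp: PiE_iff)
  moreover have "openin (cube_topology n) B"
    unfolding B_def cube_topology_def by (subst openin_PiE) (auto simp: openin_open)
  moreover have "B \<subseteq> U"
    using V(3) PiE_mono[of "{..<n}" _ V] e(2) unfolding B_def by (metis (no_types, lifting) lessThan_iff order_trans)
  moreover have "{x..y} \<subseteq> B" if "x \<in> B" "y \<in> B" for x y
  proof
    fix z assume "z \<in> {x..y}"
    moreover have "{x i..y i} \<subseteq> {0..1} \<inter> ball (p i) (e i)" if "i < n" for i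
    proof -
      have "x i \<in> {0..1} \<inter> ball (p i) (e i)" "y i \<in> {0..1} \<inter> ball (p i) (e i)"
        using \<open>x \<in> B\<close> \<open>y \<in> B\<close> that unfolding B_def by (simp_all add: PiE_iff)
      then have "0 \<le> x i" "y i \<le> 1" "p i < x i + e i" "y i < p i + e i"
        by (simp_all add: dist_real_def abs_less_iff)
      then show ?thesis
        by (intro subsetI) (simp add: dist_real_def abs_less_iff)
    qed
    ultimately show "z \<in> B"
      using that PiE_order_convex[of x "{..<n}" "\<lambda>i. {0..1} \<inter> ball (p i) (e i)" y z]
      unfolding B_def by (simp only: lessThan_iff atLeastAtMost_iff)
  qed
  ultimately show thesis
    using that by blast
qed

lemma closedin_interval:
  assumes "x \<in> topspace (cube_topology n)" "y \<in> topspace (cube_topology n)"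
  shows "closedin (cube_topology n) {x..y}"
proof -
  have "{x..y} = (\<Pi>\<^sub>E i\<in>{..<n}. {x i..y i})" if "x \<le> y"
  proof (intro equalityI subsetI)
    show "z \<in> (\<Pi>\<^sub>E i\<in>{..<n}. {x i..y i})" if "z \<in> {x..y}" for z
      using that assms \<open>x \<le> y\<close> PiE_order_convex[of x "{..<n}" "\<lambda>i. {x i..y i}" y z]
      by (auto simp: topspace_cube PiE_iff le_fun_def)
    show "z \<in> {x..y}" if "z \<in> (\<Pi>\<^sub>E i\<in>{..<n}. {x i..y i})" for z
      unfolding atLeastAtMost_iff le_fun_def
    proof (intro conjI allI)
      fix i
      show "x i \<le> z i" "z i \<le> y i"
        using that assms PiE_mem[OF that, of i] by (cases "i < n"; simp add: topspace_cube PiE_iff extensional_def)+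
    qed
  qed
  moreover have "closedin (top_of_set {0..1}) {x i..y i}" if "i < n" for i
    using assms that by (intro closed_subset) (auto simp: topspace_cube PiE_iff)
  ultimately show ?thesis
    by (cases "x \<le> y") (auto simp: cube_topology_def closedin_product_topology)
qed

lemma circulation_preorder:
  assumes "is_circulation T c" "openin T U"
  shows "preorder_on U (c U)"
  using assms unfolding is_circulation_def by (metis (no_types, lifting) Union_insert Union_empty Un_empty_right insertE empty_iff)

text \<open>The sets \<open>U\<close> and \<open>V\<close> cover \<open>U\<close>, so
  \<open>c V\<close> is among the preorders that generate \<open>c U\<close>.\<close>

lemma circulation_mono:
  assumes "is_circulation T c" "openin T U" "openin T V" "V \<subseteq> U"
  shows "c V \<subseteq> c U"
proof -
  have "\<Union>{U, V} = U"
    using assms(4) by auto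
  then show ?thesis
    using assms(1)[unfolded is_circulation_def, THEN conjunct1, THEN spec, of "{U, V}"] assms(2,3) by simp
qed

lemma circulation_least:
  assumes "is_circulation T c" "\<And>U. U \<in> \<O> \<Longrightarrow> openin T U" "preorder_on (\<Union>\<O>) r"
    "\<And>U. U \<in> \<O> \<Longrightarrow> c U \<subseteq> r"
  shows "c (\<Union>\<O>) \<subseteq> r"
  using assms(1)[unfolded is_circulation_def, THEN conjunct1, THEN spec, of \<O>] assms(2-) by blast

section \<open>The preorders generated by order intervals\<close>

definition interval_rel :: "point set \<Rightarrow> point rel" where
  "interval_rel U = {(x, y). x \<le> y \<and> {x..y} \<subseteq> U}"

definition cube_circ :: "nat \<Rightarrow> point set \<Rightarrow> point rel" where
  "cube_circ n U = (if openin (cube_topology n) U then (interval_rel U)\<^sup>+ else {})"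

lemma interval_rel_mono: "U \<subseteq> V \<Longrightarrow> interval_rel U \<subseteq> interval_rel V"
  by (auto simp: interval_rel_def)

lemma trancl_interval_rel_le:
  assumes "(x, y) \<in> (interval_rel U)\<^sup>+"
  shows "x \<le> y \<and> x \<in> U \<and> y \<in> U"
  using assms by (induction rule: trancl.induct) (auto simp: interval_rel_def)

lemma preorder_trancl_interval_rel: "preorder_on U ((interval_rel U)\<^sup>+)"
  unfolding preorder_on_def
proof (intro conjI)
  show "(interval_rel U)\<^sup>+ \<subseteq> U \<times> U"
    using trancl_interval_rel_le by (intro subrelI) blast
  show "refl_on U ((interval_rel U)\<^sup>+)"
    by (intro refl_onI r_into_trancl) (simp add: interval_rel_def)
qed simp

text \<open>Bisection along the straight segment from \<open>x\<close> to \<open>y\<close>: the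
  segment is monotone and stays in \<open>{x..y}\<close>, so short pieces of it are comparable pairs
  inside one neighbourhood \<open>B\<close>, and transitivity joins them. It cuts a long step into
  small ones, both for covers of an open set and for monotone maps.\<close>

lemma segment_Bolzano:
  fixes x y :: point
  assumes xy: "x \<in> topspace (cube_topology n)" "y \<in> topspace (cube_topology n)" "x \<le> y"
    and "trans r"
    and loc: "\<And>p. p \<in> {x..y} \<Longrightarrow> \<exists>B. openin (cube_topology n) B \<and> p \<in> B \<and>
        (\<forall>u\<in>B. \<forall>v\<in>B. x \<le> u \<and> u \<le> v \<and> v \<le> y \<longrightarrow> (u, v) \<in> r)"
  shows "(x, y) \<in> r"
proof -
  define p where "p s = (\<lambda>i\<in>{..<n}. x i + s * (y i - x i))" for s :: real
  have xyi: "0 \<le> x i" "y i \<le> 1" "x i \<le> y i" if "i < n" for i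
    using xy that by (auto simp: topspace_cube PiE_iff le_fun_def)
  have mono: "p s \<le> p t" if "s \<le> t" for s t
    using xyi that by (auto simp: p_def le_fun_def intro!: mult_right_mono)
  have p0: "p 0 = x" and p1: "p 1 = y"
    using xy by (auto simp: p_def topspace_cube PiE_iff extensional_def)
  have p_in: "p s \<in> {x..y}" if "s \<in> {0..1}" for s
    using mono[of 0 s] mono[of s 1] that p0 p1 by auto
  have cube: "p s \<in> topspace (cube_topology n)" if "s \<in> {0..1}" for s
  proof -
    have "0 \<le> p s i \<and> p s i \<le> 1" if "i < n" for i
      using p_in[OF \<open>s \<in> {0..1}\<close>] xyi[OF that] by (auto simp: le_fun_def) (meson order_trans)+
    then show ?thesis
      by (auto simp: topspace_cube PiE_iff p_def)
  qed
  have cont: "continuous_map (top_of_set {0..1}) (cube_topology n) p"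
    unfolding cube_topology_def continuous_map_componentwise
  proof (intro conjI ballI)
    show "p ` topspace (top_of_set {0..1}) \<subseteq> extensional {..<n}"
      by (auto simp: p_def)
    fix i assume i: "i \<in> {..<n}"
    have "continuous_on {0..1} (\<lambda>s. p s i)"
      using i by (simp add: p_def) (intro continuous_intros)
    moreover have "p s i \<in> {0..1}" if "s \<in> {0..1}" for s
      using PiE_mem[OF cube[OF that, unfolded topspace_cube] i] .
    ultimately show "continuous_map (top_of_set {0..1}) (top_of_set {0..1}) (\<lambda>s. p s i)"
      by auto
  qed
  have "0 \<le> (0::real) \<and> (1::real) \<le> 1 \<longrightarrow> (p 0, p 1) \<in> r"
  \<comment> \<open>The local condition of the bisection principle ranges over all nearby
    parameters; the guard makes it vacuous outside the unit interval, where \<open>p\<close> may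
    leave the cube.\<close>
  proof (rule Bolzano[of "0::real" 1 "\<lambda>a b. 0 \<le> a \<and> b \<le> 1 \<longrightarrow> (p a, p b) \<in> r"], goal_cases)
    case (2 a b c)
    then show ?case
      using \<open>trans r\<close> by (auto dest: transD)
  next
    case (3 s)
    then have s: "s \<in> {0..1}"
      by simp
    obtain B where B: "openin (cube_topology n) B" "p s \<in> B"
      "\<And>u v. u \<in> B \<Longrightarrow> v \<in> B \<Longrightarrow> x \<le> u \<Longrightarrow> u \<le> v \<Longrightarrow> v \<le> y \<Longrightarrow> (u, v) \<in> r"
      using loc[OF p_in[OF s]] by blast
    have "openin (top_of_set {0..1}) {t \<in> {0..1}. p t \<in> B}"
      using openin_continuous_map_preimage[OF cont B(1)] by simp
    then obtain T where T: "open T" "{t \<in> {0..1}. p t \<in> B} = {0..1} \<inter> T"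
      by (auto simp: openin_open)
    then have "s \<in> T"
      using s B(2) by blast
    then obtain e where e: "e > 0" "ball s e \<subseteq> T"
      using T(1) open_contains_ball by blast
    have "(p a, p b) \<in> r" if "a \<le> s" "s \<le> b" "b - a < e" "0 \<le> a" "b \<le> 1" for a b
    proof -
      have "a \<in> ball s e" "b \<in> ball s e"
        using that by (simp_all add: dist_real_def)
      then have "a \<in> T" "b \<in> T"
        using e(2) by blast+
      then have "a \<in> {0..1} \<inter> T" "b \<in> {0..1} \<inter> T"
        using that s by simp_all
      then have "p a \<in> B" "p b \<in> B"
        unfolding T(2)[symmetric] by simp_all
      then show ?thesis
        using B(3)[of "p a" "p b"] p_in[of a] p_in[of b] mono[of a b] that by auto
    qed
    then show ?case
      using e(1) by blast
  qed auto
  then show ?thesis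
    using p0 p1 by simp
qed

text \<open>The content is minimality: an order interval inside \<open>\<Union>\<O>\<close> need not
  lie in any one member, but its segment breaks into steps inside convex open sets, each contained
  in a member of \<open>\<O>\<close>.\<close>

lemma is_circulation_cube_circ: "is_circulation (cube_topology n) (cube_circ n)"
  unfolding is_circulation_def
proof (intro conjI allI impI)
  fix \<O> assume op: "\<forall>U\<in>\<O>. openin (cube_topology n) U"
  then have opU: "openin (cube_topology n) (\<Union>\<O>)"
    by auto
  show "preorder_on (\<Union>\<O>) (cube_circ n (\<Union>\<O>))"
    using opU preorder_trancl_interval_rel by (simp add: cube_circ_def)
  show "\<forall>U\<in>\<O>. cube_circ n U \<subseteq> cube_circ n (\<Union>\<O>)"
    using opU by (auto simp: cube_circ_def Union_upper elim!: trancl_mono intro: interval_rel_mono[THEN subsetD])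
  fix r assume r: "preorder_on (\<Union>\<O>) r \<and> (\<forall>U\<in>\<O>. cube_circ n U \<subseteq> r)"
  then have tr: "trans r"
    by (simp add: preorder_on_def)
  have "(x, y) \<in> r" if "(x, y) \<in> interval_rel (\<Union>\<O>)" for x y
  proof (rule segment_Bolzano[OF _ _ _ tr])
    have xy: "x \<le> y" "{x..y} \<subseteq> \<Union>\<O>"
      using that by (auto simp: interval_rel_def)
    then show "x \<in> topspace (cube_topology n)" "y \<in> topspace (cube_topology n)" "x \<le> y"
      using openin_subset[OF opU] by (meson atLeastAtMost_iff order_refl subsetD)+
    fix p assume "p \<in> {x..y}"
    then obtain U where U: "U \<in> \<O>" "p \<in> U"
      using xy(2) by blast
    then obtain B where B: "openin (cube_topology n) B" "p \<in> B" "B \<subseteq> U"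
      "\<And>x y. x \<in> B \<Longrightarrow> y \<in> B \<Longrightarrow> {x..y} \<subseteq> B"
      using convex_neighbourhood op by metis
    have "(u, v) \<in> r" if "u \<in> B" "v \<in> B" "u \<le> v" for u v
    proof -
      have "(u, v) \<in> interval_rel U"
        using that B(3) B(4)[of u v] by (auto simp: interval_rel_def)
      then have "(u, v) \<in> cube_circ n U"
        using U(1) op by (auto simp: cube_circ_def)
      then show ?thesis
        using r U(1) by blast
    qed
    then show "\<exists>B. openin (cube_topology n) B \<and> p \<in> B \<and>
        (\<forall>u\<in>B. \<forall>v\<in>B. x \<le> u \<and> u \<le> v \<and> v \<le> y \<longrightarrow> (u, v) \<in> r)"
      using B by blast
  qed
  then have "interval_rel (\<Union>\<O>) \<subseteq> r"
    by auto
  then have "(interval_rel (\<Union>\<O>))\<^sup>+ \<subseteq> r\<^sup>+"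
    by (auto elim: trancl_mono)
  then show "cube_circ n (\<Union>\<O>) \<subseteq> r"
    using opU tr by (simp add: cube_circ_def)
qed (simp add: cube_circ_def)

text \<open>
  If \<open>[x, y] \<subseteq> U\<close>, then \<open>U\<close> and the complement of the closed set \<open>[x, y]\<close> cover the cube. A chain of
  steps from \<open>x\<close> to \<open>y\<close>, each in one of these two sets, stays in \<open>[x, y]\<close>, so all its steps are in \<open>U\<close>.
\<close>

lemma cube_circ_unique:
  assumes c: "is_circulation (cube_topology n) c"
    and top: "c (topspace (cube_topology n)) =
      {(x, y). x \<in> topspace (cube_topology n) \<and> y \<in> topspace (cube_topology n) \<and> x \<le> y}"
  shows "c = cube_circ n"
proof
  fix U
  let ?T = "topspace (cube_topology n)"
  show "c U = cube_circ n U"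
  proof (cases "openin (cube_topology n) U")
    case False
    then show ?thesis
      using c by (simp add: cube_circ_def is_circulation_def)
  next
    case U: True
    note pre = circulation_preorder[OF c]
    have c_le: "x \<le> y \<and> x \<in> V \<and> y \<in> V" if "openin (cube_topology n) V" "(x, y) \<in> c V" for V x y
      using circulation_mono[OF c openin_topspace that(1) openin_subset[OF that(1)]] that top pre[OF that(1)]
      by (auto simp: preorder_on_def)
    have "(x, y) \<in> c U" if "(x, y) \<in> interval_rel U" for x y
    proof -
      have xy: "x \<le> y" "{x..y} \<subseteq> U"
        using that by (auto simp: interval_rel_def)
      then have T: "x \<in> ?T" "y \<in> ?T"
        using openin_subset[OF U] by auto
      define W where "W = ?T - {x..y}"
      \<comment> \<open>The chain argument in relational form. \<open>r\<close> is transitive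
        because a point between two points of \<open>{x..y}\<close> is itself in
        \<open>{x..y}\<close>; a step in \<open>W\<close> satisfies the implication
        vacuously.\<close>
      define r where "r = {(u, v). u \<in> ?T \<and> v \<in> ?T \<and> u \<le> v \<and> (u \<in> {x..y} \<and> v \<in> {x..y} \<longrightarrow> (u, v) \<in> c U)}"
      have W: "openin (cube_topology n) W"
        using closedin_interval[OF T] by (simp add: W_def openin_diff)
      have un: "\<Union>{U, W} = ?T"
        using xy openin_subset[OF U] by (auto simp: W_def)
      have "preorder_on ?T r"
        unfolding preorder_on_def
      proof (intro conjI transI)
        show "r \<subseteq> ?T \<times> ?T"
          by (auto simp: r_def)
        show "refl_on ?T r"
          using pre[OF U] xy(2) by (auto simp: r_def refl_on_def preorder_on_def)
        show "(u, w) \<in> r" if "(u, v) \<in> r" "(v, w) \<in> r" for u v w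
          using that pre[OF U] unfolding r_def preorder_on_def
          by (auto dest: transD intro: order_trans)
      qed
      moreover have "c V \<subseteq> r" if "V \<in> {U, W}" for V
      proof (rule subrelI)
        fix u v assume uv: "(u, v) \<in> c V"
        have V: "openin (cube_topology n) V" "V = U \<or> V = W"
          using that U W by auto
        have "u \<le> v" "u \<in> V" "v \<in> V" "V \<subseteq> ?T"
          using c_le[OF V(1) uv] openin_subset[OF V(1)] by simp_all
        then show "(u, v) \<in> r"
          using V(2) uv unfolding r_def W_def by blast
      qed
      ultimately have "c ?T \<subseteq> r"
        using circulation_least[OF c, of "{U, W}" r] U W un by auto
      moreover have "(x, y) \<in> c ?T"
        using T xy top by simp
      ultimately show ?thesis
        using xy by (auto simp: r_def)
    qed
    then have "interval_rel U \<subseteq> c U"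
      by auto
    then have "(interval_rel U)\<^sup>+ \<subseteq> (c U)\<^sup>+"
      by (auto elim: trancl_mono)
    then have 1: "cube_circ n U \<subseteq> c U"
      using U pre[OF U] by (simp add: cube_circ_def preorder_on_def)
    \<comment> \<open>For the converse inclusion \<open>U\<close> is covered by convex open sets. On
      such a set \<open>c\<close> is contained in the coordinatewise order, and comparable points of
      a convex subset of \<open>U\<close> form a generating step.\<close>
    define \<O> where "\<O> = {B. openin (cube_topology n) B \<and> B \<subseteq> U \<and> (\<forall>x\<in>B. \<forall>y\<in>B. {x..y} \<subseteq> B)}"
    have un: "\<Union>\<O> = U"
    proof (intro equalityI subsetI)
      fix p assume "p \<in> U"
      then obtain B where "openin (cube_topology n) B" "p \<in> B" "B \<subseteq> U"
        "\<And>x y. x \<in> B \<Longrightarrow> y \<in> B \<Longrightarrow> {x..y} \<subseteq> B"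
        using convex_neighbourhood[OF U] by metis
      then have "B \<in> \<O>"
        unfolding \<O>_def by blast
      then show "p \<in> \<Union>\<O>"
        using \<open>p \<in> B\<close> by blast
    qed (auto simp: \<O>_def)
    have "c B \<subseteq> (interval_rel U)\<^sup>+" if "B \<in> \<O>" for B
    proof -
      have "(x, y) \<in> interval_rel U" if "(x, y) \<in> c B" for x y
        using that \<open>B \<in> \<O>\<close> c_le[of B x y] unfolding \<O>_def interval_rel_def by blast
      then show ?thesis
        by auto
    qed
    then have "c (\<Union>\<O>) \<subseteq> (interval_rel U)\<^sup>+"
      by (intro circulation_least[OF c]) (auto simp: un preorder_trancl_interval_rel, auto simp: \<O>_def)
    then show ?thesis
      using 1 U un by (auto simp: cube_circ_def)
  qed
qed

text \<open>This resolves the definite description in \<open>dcube\<close>: on the whole cube the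
  generating steps already form the coordinatewise order, which is transitive, so
  \<open>cube_circ n\<close> has the prescribed top value.\<close>

lemma circ_dcube: "circ (dcube n) = cube_circ n"
proof -
  let ?T = "topspace (cube_topology n)"
  have "interval_rel ?T = {(x, y). x \<in> ?T \<and> y \<in> ?T \<and> x \<le> y}"
  proof (intro equalityI subrelI)
    show "(x, y) \<in> {(x, y). x \<in> ?T \<and> y \<in> ?T \<and> x \<le> y}" if "(x, y) \<in> interval_rel ?T" for x y
      using that by (simp add: interval_rel_def subset_iff)
    fix x y assume "(x, y) \<in> {(x, y). x \<in> ?T \<and> y \<in> ?T \<and> x \<le> y}"
    then have xy: "x \<in> ?T" "y \<in> ?T" "x \<le> y"
      by auto
    have "z \<in> ?T" if "x \<le> z" "z \<le> y" for z
      using that xy PiE_order_convex[of x "{..<n}" "\<lambda>_. {0..1}" y z]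
      by (simp add: topspace_cube PiE_iff)
    then show "(x, y) \<in> interval_rel ?T"
      using xy by (auto simp: interval_rel_def)
  qed
  moreover have "trans {(x, y). x \<in> ?T \<and> y \<in> ?T \<and> x \<le> y}"
    by (auto simp: trans_def)
  ultimately have top: "cube_circ n ?T = {(x, y). x \<in> ?T \<and> y \<in> ?T \<and> x \<le> y}"
    by (simp add: cube_circ_def)
  have "(THE c. is_circulation (cube_topology n) c \<and>
      c ?T = {(x, y). x \<in> ?T \<and> y \<in> ?T \<and> x \<le> y}) = cube_circ n"
    using is_circulation_cube_circ cube_circ_unique top by (intro the_equality conjI) (assumption | elim conjE)+
  then show ?thesis
    by (simp add: dcube_def)
qed


section \<open>Stream maps\<close>

lemma circ_dcubeI:
  assumes "openin (cube_topology n) U" "x \<le> y" "{x..y} \<subseteq> U"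
  shows "(x, y) \<in> circ (dcube n) U"
  using assms by (auto simp: circ_dcube cube_circ_def interval_rel_def)

lemma trans_circ:
  assumes "stream X"
  shows "trans (circ X U)"
  using assms circulation_preorder[of "space_of X" "circ X" U]
  by (cases "openin (space_of X) U") (auto simp: stream_def preorder_on_def is_circulation_def)

lemma stream_dcube: "stream (dcube n)"
  by (simp add: stream_def circ_dcube space_of_dcube is_circulation_cube_circ)

text \<open>The source preorder is a transitive closure and the target preorders are transitive, so
  testing the generating steps suffices.\<close>

lemma stream_map_dcubeI:
  assumes "stream X" "continuous_map (cube_topology n) (space_of X) f"
    and "\<And>U x y. openin (space_of X) U \<Longrightarrow> x \<in> pts (dcube n) \<Longrightarrow> y \<in> pts (dcube n) \<Longrightarrow> x \<le> y \<Longrightarrow>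
      (\<And>z. z \<in> {x..y} \<Longrightarrow> f z \<in> U) \<Longrightarrow> (f x, f y) \<in> circ X U"
  shows "stream_map (dcube n) X f"
  unfolding stream_map_def
proof (intro conjI allI impI)
  show "continuous_map (space_of (dcube n)) (space_of X) f"
    using assms(2) by (simp add: space_of_dcube)
  fix U x y
  assume "openin (space_of X) U \<and> (x, y) \<in> circ (dcube n) {z \<in> pts (dcube n). f z \<in> U}"
  then have U: "openin (space_of X) U" "(x, y) \<in> (interval_rel {z \<in> pts (dcube n). f z \<in> U})\<^sup>+"
    by (auto simp: circ_dcube cube_circ_def split: if_splits)
  have "(f u, f v) \<in> circ X U" if "(u, v) \<in> interval_rel {z \<in> pts (dcube n). f z \<in> U}" for u v
    using that U(1) by (intro assms(3)) (auto simp: interval_rel_def)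
  with U(2) show "(f x, f y) \<in> circ X U"
    by (induction rule: trancl.induct) (auto intro: transD[OF trans_circ[OF assms(1)]])
qed

text \<open>A step is cut along its segment until each piece maps into a convex open subset of
  \<open>U\<close>; there monotonicity alone turns the image into a generating step.\<close>

lemma stream_map_cubeI:
  assumes cont: "continuous_map (cube_topology m) (cube_topology n) f"
    and mono: "\<And>x y. x \<in> pts (dcube m) \<Longrightarrow> y \<in> pts (dcube m) \<Longrightarrow> x \<le> y \<Longrightarrow> f x \<le> f y"
  shows "stream_map (dcube m) (dcube n) f"
proof (rule stream_map_dcubeI[OF stream_dcube])
  show "continuous_map (cube_topology m) (space_of (dcube n)) f"
    using cont by (simp add: space_of_dcube)
  fix U x y
  assume U: "openin (space_of (dcube n)) U" and xy: "x \<in> pts (dcube m)" "y \<in> pts (dcube m)" "x \<le> y"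
    and fU: "\<And>z. z \<in> {x..y} \<Longrightarrow> f z \<in> U"
  define r where "r = inv_image (circ (dcube n) U) f"
  have "(x, y) \<in> r"
  proof (rule segment_Bolzano[of _ m])
    show "trans r"
      unfolding r_def by (intro trans_inv_image trans_circ stream_dcube)
    fix p assume p: "p \<in> {x..y}"
    obtain B where B: "openin (cube_topology n) B" "f p \<in> B" "B \<subseteq> U"
      "\<And>x y. x \<in> B \<Longrightarrow> y \<in> B \<Longrightarrow> {x..y} \<subseteq> B"
      using convex_neighbourhood[of n U "f p"] U fU[OF p] by (metis space_of_dcube)
    define A where "A = {z \<in> topspace (cube_topology m). f z \<in> B}"
    have "openin (cube_topology m) A"
      unfolding A_def using openin_continuous_map_preimage[OF cont B(1)] .
    moreover have "p \<in> A"
      using p B(2) xy PiE_order_convex[of x "{..<m}" "\<lambda>_. {0..1}" y p]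
      by (auto simp: A_def topspace_cube pts_dcube PiE_iff)
    moreover have "(u, v) \<in> r" if "u \<in> A" "v \<in> A" "u \<le> v" for u v
    proof -
      have "f u \<le> f v" "{f u..f v} \<subseteq> U"
        using that mono[of u v] B(3) B(4)[of "f u" "f v"] by (auto simp: A_def topspace_cube pts_dcube)
      then show ?thesis
        using U by (auto simp: r_def space_of_dcube intro!: circ_dcubeI)
    qed
    ultimately show "\<exists>B. openin (cube_topology m) B \<and> p \<in> B \<and>
        (\<forall>u\<in>B. \<forall>v\<in>B. x \<le> u \<and> u \<le> v \<and> v \<le> y \<longrightarrow> (u, v) \<in> r)"
      by blast
  qed (use xy in \<open>auto simp: space_of_dcube\<close>)
  then show "(f x, f y) \<in> circ (dcube n) U"
    by (simp add: r_def)
qed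

lemma stream_map_compose:
  assumes "stream_map X Y f" "stream_map Y Z g"
  shows "stream_map X Z (\<lambda>x. g (f x))"
  unfolding stream_map_def
proof (intro conjI allI impI)
  show "continuous_map (space_of X) (space_of Z) (\<lambda>x. g (f x))"
    using assms continuous_map_compose[of "space_of X" "space_of Y" f "space_of Z" g]
    by (simp add: stream_map_def o_def)
  fix U x y assume U: "openin (space_of Z) U \<and> (x, y) \<in> circ X {z \<in> pts X. g (f z) \<in> U}"
  define V where "V = {z \<in> pts Y. g z \<in> U}"
  have "openin (space_of Y) V"
    using assms(2) U openin_continuous_map_preimage unfolding V_def stream_map_def by blast
  moreover have "{z \<in> pts X. g (f z) \<in> U} = {z \<in> pts X. f z \<in> V}"
    using assms continuous_map_funspace[of "space_of X" "space_of Y" f] by (auto simp: V_def stream_map_def)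
  ultimately show "(g (f x), g (f y)) \<in> circ Z U"
    using assms U unfolding stream_map_def V_def by auto
qed

lemma stream_map_cong:
  assumes "stream X" "stream_map X Y f" "\<And>x. x \<in> pts X \<Longrightarrow> f x = g x"
  shows "stream_map X Y g"
  unfolding stream_map_def
proof (intro conjI allI impI)
  show "continuous_map (space_of X) (space_of Y) g"
    using assms continuous_map_eq unfolding stream_map_def by blast
  fix U x y assume U: "openin (space_of Y) U \<and> (x, y) \<in> circ X {z \<in> pts X. g z \<in> U}"
  have eq: "{z \<in> pts X. g z \<in> U} = {z \<in> pts X. f z \<in> U}"
    using assms(3) by auto
  have "openin (space_of X) {z \<in> pts X. f z \<in> U}"
    using U assms(2) openin_continuous_map_preimage unfolding stream_map_def by blast
  then have "circ X {z \<in> pts X. f z \<in> U} \<subseteq> pts X \<times> pts X"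
    using circulation_preorder[of "space_of X" "circ X"] assms(1) unfolding stream_def preorder_on_def by blast
  then have "x \<in> pts X" "y \<in> pts X"
    using U eq by auto
  moreover have "(f x, f y) \<in> circ Y U"
    using U eq assms(2) by (auto simp: stream_map_def)
  ultimately show "(g x, g y) \<in> circ Y U"
    using assms(3) by simp
qed

lemma stream_map_pts: "stream_map X Y f \<Longrightarrow> x \<in> pts X \<Longrightarrow> f x \<in> pts Y"
  using continuous_map_funspace[of "space_of X" "space_of Y" f] by (auto simp: stream_map_def)

lemma compose_stream_hom:
  assumes "stream X" "f \<in> stream_hom X Y" "g \<in> stream_hom Y Z"
  shows "compose (pts X) g f \<in> stream_hom X Z"
  using assms stream_map_compose[of X Y f Z g] stream_map_cong[of X Z "\<lambda>x. g (f x)" "compose (pts X) g f"]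
  by (auto simp: stream_hom_def compose_def)


section \<open>Affine maps of cubes\<close>

lemma grid_iff: "x \<in> grid k n \<longleftrightarrow> x \<in> extensional {..<n} \<and> (\<forall>i<n. x i \<le> k)"
  by (auto simp: grid_def PiE_iff)

lemma grid_ext:
  assumes "x \<in> grid k n" "y \<in> grid l n" "\<And>i. i < n \<Longrightarrow> x i = y i"
  shows "x = y"
  using assms by (auto simp: grid_iff intro: extensionalityI)

text \<open>An affine function of at most one coordinate. With slope \<open>d = 0\<close> the index
  \<open>i\<close> is a dummy, so constants fit even when \<open>k = 0\<close> and there is no
  coordinate to name.\<close>

definition coord_affine :: "nat \<Rightarrow> (vertex \<Rightarrow> real) \<Rightarrow> nat \<Rightarrow> real \<Rightarrow> real \<Rightarrow> bool" where
  "coord_affine k g i p d \<longleftrightarrow> (d = 0 \<or> i < k) \<and> (\<forall>x\<in>grid 1 k. g x = p + d * real (x i))"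

text \<open>A common condition for the two families passed to \<open>affine_ext\<close>: morphisms
  of the cube category and halved cells of the subdivided cube. The sign of \<open>d\<close> gives
  monotonicity, the bounds keep the values in \<open>[0,1]\<close>.\<close>

definition affine_cube_map :: "nat \<Rightarrow> nat \<Rightarrow> (vertex \<Rightarrow> nat \<Rightarrow> real) \<Rightarrow> bool" where
  "affine_cube_map m n g \<longleftrightarrow>
     (\<forall>j<n. \<exists>i p d. coord_affine m (\<lambda>x. g x j) i p d \<and> 0 \<le> d \<and> 0 \<le> p \<and> p + d \<le> 1)"

text \<open>Only the unit vector in direction \<open>i\<close> changes the value, so at most one
  summand survives. If \<open>i\<close> is out of range, \<open>t i\<close> is unspecified but is
  multiplied by \<open>d = 0\<close>.\<close>

lemma affine_ext_eq:
  assumes "t \<in> pts (dcube m)" "j < n" "coord_affine m (\<lambda>x. g x j) i p d"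
  shows "affine_ext m n g t j = p + d * t i"
proof -
  define z where "z = (\<lambda>l\<in>{..<m}. 0 :: nat)"
  define u where "u l = (\<lambda>k\<in>{..<m}. if k = l then 1 else 0 :: nat)" for l
  have g: "g x j = p + d * real (x i)" if "x \<in> grid 1 m" for x
    using assms(3) that by (simp add: coord_affine_def)
  have "z \<in> grid 1 m" "u l \<in> grid 1 m" for l
    by (simp_all add: grid_iff z_def u_def)
  then have gz: "g z j = p + d * real (z i)" and gu: "g (u l) j = p + d * real (u l i)" for l
    using g by simp_all
  have dz: "d * real (z i) = 0"
    using assms(3) by (auto simp: coord_affine_def z_def)
  have du: "d * real (u l i) = (if l = i then d else 0)" if "l < m" for l
    using assms(3) that by (auto simp: coord_affine_def u_def)
  have "affine_ext m n g t j = g z j + (\<Sum>l<m. t l * (g (u l) j - g z j))"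
    using assms(1,2) by (simp add: affine_ext_def z_def u_def)
  also have "\<dots> = p + (\<Sum>l<m. if l = i then d * t i else 0)"
    unfolding gz gu dz using du by (intro arg_cong2[of _ _ _ _ "(+)"] sum.cong) auto
  also have "\<dots> = p + d * t i"
    using assms(3) by (auto simp: coord_affine_def)
  finally show ?thesis .
qed

lemma affine_ext_extensional: "t \<in> pts (dcube m) \<Longrightarrow> affine_ext m n g t \<in> extensional {..<n}"
  by (simp add: affine_ext_def)

lemma affine_ext_stream_hom:
  assumes g: "affine_cube_map m n g"
  shows "affine_ext m n g \<in> stream_hom (dcube m) (dcube n)"
proof -
  obtain i p d where ipd: "\<And>j. j < n \<Longrightarrow> coord_affine m (\<lambda>x. g x j) (i j) (p j) (d j)"
    "\<And>j. j < n \<Longrightarrow> 0 \<le> d j" "\<And>j. j < n \<Longrightarrow> 0 \<le> p j" "\<And>j. j < n \<Longrightarrow> p j + d j \<le> 1"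
    using g unfolding affine_cube_map_def by metis
  have val: "affine_ext m n g t j = p j + d j * t (i j)" if "t \<in> pts (dcube m)" "j < n" for t j
    using affine_ext_eq[of t m j n g, OF that ipd(1)[OF that(2)]] .
  have coord: "d j = 0 \<or> i j < m" if "j < n" for j
    using ipd(1)[OF that] by (simp add: coord_affine_def)
  have range: "affine_ext m n g t j \<in> {0..1}" if "t \<in> pts (dcube m)" "j < n" for t j
  proof (cases "d j = 0")
    case True
    then show ?thesis
      using val[OF that] ipd(2-4)[OF that(2)] by simp
  next
    case False
    then have "t (i j) \<in> {0..1}"
      using coord[OF that(2)] PiE_mem[OF that(1)[unfolded pts_dcube], of "i j"] by simp
    then have "0 \<le> d j * t (i j)" "d j * t (i j) \<le> d j"
      using ipd(2)[OF that(2)] by (auto intro: mult_left_le)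
    then show ?thesis
      using val[OF that] ipd(3,4)[OF that(2)] by simp
  qed
  have "stream_map (dcube m) (dcube n) (affine_ext m n g)"
  proof (rule stream_map_cubeI)
    fix x y :: point assume xy: "x \<in> pts (dcube m)" "y \<in> pts (dcube m)" "x \<le> y"
    show "affine_ext m n g x \<le> affine_ext m n g y"
      unfolding le_fun_def
    proof
      fix j
      show "affine_ext m n g x j \<le> affine_ext m n g y j"
      proof (cases "j < n")
        case True
        then show ?thesis
          using val[OF xy(1) True] val[OF xy(2) True] ipd(2)[OF True] xy(3)
          by (simp add: le_fun_def mult_left_mono)
      next
        case False
        then show ?thesis
          using xy by (simp add: affine_ext_def)
      qed
    qed
  next
    show "continuous_map (cube_topology m) (cube_topology n) (affine_ext m n g)"
      unfolding cube_topology_def continuous_map_componentwise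
    proof (intro conjI ballI)
      show "affine_ext m n g ` topspace (product_topology (\<lambda>i. top_of_set {0..1}) {..<m}) \<subseteq> extensional {..<n}"
        using affine_ext_extensional by (auto simp: pts_dcube)
      fix j assume j: "j \<in> {..<n}"
      have "continuous_map (cube_topology m) euclideanreal (\<lambda>t. p j + d j * t (i j))"
      proof (cases "d j = 0")
        case False
        then have "continuous_map (cube_topology m) (top_of_set {0..1}) (\<lambda>t. t (i j))"
          using coord[of j] j unfolding cube_topology_def by (intro continuous_map_product_projection) auto
        then have "continuous_map (cube_topology m) euclideanreal (\<lambda>t. t (i j))"
          using continuous_map_into_fulltopology by blast
        then show ?thesis
          by (intro continuous_intros) auto
      qed simp
      then have "continuous_map (cube_topology m) euclideanreal (\<lambda>t. affine_ext m n g t j)"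
        using val j by (elim continuous_map_eq) (simp add: topspace_cube pts_dcube)
      then show "continuous_map (product_topology (\<lambda>i. top_of_set {0..1}) {..<m}) (top_of_set {0..1})
          (\<lambda>t. affine_ext m n g t j)"
        using range j unfolding cube_topology_def[symmetric]
        by (intro continuous_map_into_subtopology) (auto simp: topspace_cube pts_dcube)
    qed
  qed
  then show ?thesis
    by (simp add: stream_hom_def affine_ext_def)
qed

section \<open>Morphisms of the cube category in coordinates, and their realizations\<close>

lemma box_maps_grid: "box m n f \<Longrightarrow> f \<in> grid 1 m \<rightarrow>\<^sub>E grid 1 n"
proof (induction rule: box.induct)
  case (box_permutation p n)
  then have "p j < n" if "j < n" for j
    using permutes_in_image[of p "{..<n}" j] that by auto
  then show ?case
    by (auto simp: coordinate_permutation_def grid_iff extensional_def)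
next
  case (box_compose l m g n f)
  then show ?case
    by (auto simp: compose_def PiE_iff Pi_iff extensional_def)
qed (auto simp: box_id_def coface_def codegeneracy_def grid_iff extensional_def)

text \<open>By induction over the generators. Monotonicity, the lattice laws and realization all
  follow from this form. It does not exclude diagonals such as \<open>(x, x)\<close>, so images of
  intervals need the generators again.\<close>

lemma box_coordinate:
  assumes "box m n f" "j < n"
  shows "(\<exists>e\<le>1. \<forall>x\<in>grid 1 m. f x j = e) \<or> (\<exists>i<m. \<forall>x\<in>grid 1 m. f x j = x i)"
  using assms
proof (induction arbitrary: j rule: box.induct)
  case (box_coface i n e)
  then show ?case
  proof (cases "j = i")
    case True
    then show ?thesis
      using box_coface by (intro disjI1 exI[of _ e]) (auto simp: coface_def)
  next
    case False
    then show ?thesis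
      using box_coface
      by (intro disjI2 exI[of _ "if j < i then j else j - 1"]) (auto simp: coface_def)
  qed
next
  case (box_codegeneracy i n)
  then show ?case
    by (intro disjI2 exI[of _ "if j < i then j else Suc j"]) (auto simp: codegeneracy_def)
next
  case (box_permutation p n)
  then have "p j < n"
    using permutes_in_image[of p "{..<n}" j] by auto
  then show ?case
    using box_permutation.prems by (auto simp: coordinate_permutation_def)
next
  case (box_compose l m g n f)
  have g: "g x \<in> grid 1 m" if "x \<in> grid 1 l" for x
    using box_maps_grid[OF box_compose.hyps(1)] that by auto
  from box_compose.IH(2)[OF box_compose.prems] show ?case
  proof (elim disjE exE conjE)
    fix i assume "i < m" "\<forall>x\<in>grid 1 m. f x j = x i"
    then show ?thesis
      using box_compose.IH(1)[of i] g by (simp add: compose_def)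
  qed (use g in \<open>auto simp: compose_def\<close>)
qed (auto simp: box_id_def)

lemma box_real_constant:
  assumes "t \<in> pts (dcube m)" "j < n" "\<And>x. x \<in> grid 1 m \<Longrightarrow> f x j = e"
  shows "box_real m n f t j = real e"
  using affine_ext_eq[OF assms(1,2), of "\<lambda>v j. real (f v j)" 0 "real e" 0] assms(3)
  by (simp add: box_real_def coord_affine_def)

lemma box_real_coordinate:
  assumes "t \<in> pts (dcube m)" "j < n" "i < m" "\<And>x. x \<in> grid 1 m \<Longrightarrow> f x j = x i"
  shows "box_real m n f t j = t i"
  using affine_ext_eq[OF assms(1,2), of "\<lambda>v j. real (f v j)" i 0 1] assms(3,4)
  by (simp add: box_real_def coord_affine_def)

lemma affine_cube_map_box: "box m n f \<Longrightarrow> affine_cube_map m n (\<lambda>v j. real (f v j))"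
  unfolding affine_cube_map_def
proof (intro allI impI)
  fix j assume "box m n f" "j < n"
  from box_coordinate[OF this]
  show "\<exists>i p d. coord_affine m (\<lambda>x. real (f x j)) i p d \<and> 0 \<le> d \<and> 0 \<le> p \<and> p + d \<le> 1"
  proof (elim disjE exE conjE)
    fix e :: nat assume "e \<le> 1" "\<forall>x\<in>grid 1 m. f x j = e"
    then show ?thesis
      by (intro exI[of _ 0] exI[of _ "real e"]) (simp add: coord_affine_def)
  next
    fix i assume "i < m" "\<forall>x\<in>grid 1 m. f x j = x i"
    then show ?thesis
      by (intro exI[of _ i] exI[of _ 0] exI[of _ 1]) (simp add: coord_affine_def)
  qed
qed

lemma box_real_stream_hom: "box m n f \<Longrightarrow> box_real m n f \<in> stream_hom (dcube m) (dcube n)"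
  unfolding box_real_def by (intro affine_ext_stream_hom affine_cube_map_box)

lemma box_real_pts: "box m n f \<Longrightarrow> t \<in> pts (dcube m) \<Longrightarrow> box_real m n f t \<in> pts (dcube n)"
  using box_real_stream_hom[of m n f] stream_map_pts[of "dcube m" "dcube n" "box_real m n f" t]
  by (simp add: stream_hom_def)

text \<open>A coordinate of \<open>g\<close> reads at most one coordinate of \<open>f\<close>, which
  is constant or an input, so the composite is again affine in one coordinate. With \<open>g\<close>
  a morphism this is functoriality of realization; with \<open>g\<close> a halved cell it is the
  cocone condition for \<open>phi2\<close>.\<close>

lemma affine_ext_compose:
  assumes f: "box k m f" and g: "affine_cube_map m n g" and t: "t \<in> pts (dcube k)"
    and h: "\<And>x j. x \<in> grid 1 k \<Longrightarrow> j < n \<Longrightarrow> h x j = g (f x) j"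
  shows "affine_ext k n h t = affine_ext m n g (box_real k m f t)"
proof (rule extensionalityI[of _ "{..<n}"])
  show "affine_ext k n h t \<in> extensional {..<n}"
    "affine_ext m n g (box_real k m f t) \<in> extensional {..<n}"
    using affine_ext_extensional t box_real_pts[OF f t] by blast+
  fix j assume "j \<in> {..<n}"
  then have j: "j < n"
    by simp
  obtain i p d where ipd: "coord_affine m (\<lambda>x. g x j) i p d"
    using g j unfolding affine_cube_map_def by blast
  have r: "affine_ext m n g (box_real k m f t) j = p + d * box_real k m f t i"
    using affine_ext_eq[of _ m j n g, OF box_real_pts[OF f t] j ipd] .
  have hx: "h x j = p + d * real (f x i)" if "x \<in> grid 1 k" for x
    using h[OF that j] ipd PiE_mem[OF box_maps_grid[OF f] that] by (simp add: coord_affine_def)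
  show "affine_ext k n h t j = affine_ext m n g (box_real k m f t) j"
  proof (cases "d = 0")
    case True
    then show ?thesis
      using affine_ext_eq[OF t j, of h 0 p 0] hx r by (simp add: coord_affine_def)
  next
    case False
    then have i: "i < m"
      using ipd by (simp add: coord_affine_def)
    from box_coordinate[OF f i] show ?thesis
    proof (elim disjE exE conjE)
      fix e assume e: "\<forall>x\<in>grid 1 k. f x i = e"
      then have "coord_affine k (\<lambda>x. h x j) 0 (p + d * real e) 0"
        using hx by (simp add: coord_affine_def)
      then show ?thesis
        using affine_ext_eq[OF t j] r box_real_constant[OF t i, of f e] e by simp
    next
      fix l assume l: "l < k" "\<forall>x\<in>grid 1 k. f x i = x l"
      then have "coord_affine k (\<lambda>x. h x j) l p d"
        using hx by (simp add: coord_affine_def)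
      then show ?thesis
        using affine_ext_eq[OF t j] r box_real_coordinate[OF t i l(1), of f] l(2) by simp
    qed
  qed
qed

lemma box_real_compose:
  assumes "box l m g" "box m n f" "t \<in> pts (dcube l)"
  shows "box_real l n (compose (grid 1 l) f g) t = box_real m n f (box_real l m g t)"
  unfolding box_real_def[of l n] box_real_def[of m n]
  using affine_ext_compose[OF assms(1) affine_cube_map_box[OF assms(2)] assms(3)]
  by (simp add: compose_def)

lemma box_real_id: "box_real n n (box_id n) = (\<lambda>t\<in>pts (dcube n). t)"
proof
  fix t
  show "box_real n n (box_id n) t = (\<lambda>t\<in>pts (dcube n). t) t"
  proof (cases "t \<in> pts (dcube n)")
    case True
    have "box_real n n (box_id n) t = t"
    proof (rule extensionalityI[of _ "{..<n}"])
      show "box_real n n (box_id n) t \<in> extensional {..<n}"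
        using affine_ext_extensional[OF True] by (simp add: box_real_def)
      show "t \<in> extensional {..<n}"
        using True by (simp add: pts_dcube PiE_iff)
      show "box_real n n (box_id n) t j = t j" if "j \<in> {..<n}" for j
        using that by (intro box_real_coordinate[OF True]) (auto simp: box_id_def)
    qed
    then show ?thesis
      using True by simp
  qed (simp add: box_real_def affine_ext_def)
qed

text \<open>Forgetting the coordinates in \<open>J\<close> and reinserting constants. As an
  endomorphism of the cube it compares cells along a common face without renumbering
  coordinates.\<close>

definition reset :: "nat \<Rightarrow> nat set \<Rightarrow> vertex \<Rightarrow> vertex \<Rightarrow> vertex" where
  "reset n J e = (\<lambda>x\<in>grid 1 n. \<lambda>j\<in>{..<n}. if j \<in> J then e j else x j)"

text \<open>A single coordinate is reset by a codegeneracy followed by the coface at the same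
  position; larger \<open>J\<close> are composites of these.\<close>

lemma box_reset:
  assumes "J \<subseteq> {..<n}" "\<And>j. j \<in> J \<Longrightarrow> e j \<le> 1"
  shows "box n n (reset n J e)"
proof -
  have single: "box n n (reset n {i} e)" if i: "i < n" "e i \<le> 1" for i
  proof -
    obtain n' where n: "n = Suc n'"
      using i(1) by (cases n) auto
    have "box n n (compose (grid 1 n) (coface n' i (e i)) (codegeneracy n' i))"
      unfolding n using i n by (intro box_compose[OF box_codegeneracy box_coface]) auto
    also have "compose (grid 1 n) (coface n' i (e i)) (codegeneracy n' i) = reset n {i} e"
    proof
      fix x
      show "compose (grid 1 n) (coface n' i (e i)) (codegeneracy n' i) x = reset n {i} e x"
      proof (cases "x \<in> grid 1 n")
        case True
        then have "codegeneracy n' i x \<in> grid 1 n'"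
          using n by (auto simp: codegeneracy_def grid_iff)
        moreover have "codegeneracy n' i x j = (if j < i then x j else x (Suc j))" if "j < n'" for j
          using True that n by (simp add: codegeneracy_def)
        ultimately show ?thesis
          using True i n by (auto simp: reset_def compose_def coface_def fun_eq_iff)
      qed (simp add: reset_def compose_def)
    qed
    finally show ?thesis .
  qed
  have "finite J"
    using assms(1) finite_subset by blast
  then show ?thesis
    using assms
  proof (induction J)
    case empty
    have "reset n {} e = box_id n"
      by (auto simp: reset_def box_id_def fun_eq_iff grid_iff extensional_def)
    then show ?case
      by (simp add: box_ident)
  next
    case (insert i J)
    have J: "box n n (reset n J e)"
      using insert by auto
    have "reset n (insert i J) e = compose (grid 1 n) (reset n {i} e) (reset n J e)"
    proof
      fix x
      show "reset n (insert i J) e x = compose (grid 1 n) (reset n {i} e) (reset n J e) x"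
      proof (cases "x \<in> grid 1 n")
        case True
        then have "reset n J e x \<in> grid 1 n"
          using box_maps_grid[OF J] by auto
        then show ?thesis
          using True insert by (auto simp: reset_def compose_def)
      qed (simp add: reset_def compose_def)
    qed
    then show ?case
      using box_compose[OF J single[of i]] insert.prems by simp
  qed
qed


section \<open>Cells of the subdivided cube\<close>

text \<open>
  A prime filter of \<open>[1]\<^sup>k\<close> is generated by an atom; the preimages of principal filters under a
  lattice homomorphism to a chain are nested, so only one atom occurs.
\<close>

lemma lattice_hom_chain:
  fixes g :: "vertex \<Rightarrow> nat"
  assumes inf: "\<And>x y. x \<in> grid 1 k \<Longrightarrow> y \<in> grid 1 k \<Longrightarrow> g (inf x y) = min (g x) (g y)"
    and sup: "\<And>x y. x \<in> grid 1 k \<Longrightarrow> y \<in> grid 1 k \<Longrightarrow> g (sup x y) = max (g x) (g y)"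
  shows "(\<exists>c. \<forall>x\<in>grid 1 k. g x = c) \<or>
    (\<exists>i<k. \<exists>p q. p \<le> q \<and> (\<forall>x\<in>grid 1 k. g x = (if x i = 1 then q else p)))"
proof -
  define ch where "ch J = (\<lambda>i\<in>{..<k}. if i \<in> J then 1 else 0 :: nat)" for J
  have ch: "ch J \<in> grid 1 k" for J
    by (simp add: grid_iff ch_def)
  have ch_sup: "g (ch (J \<union> K)) = max (g (ch J)) (g (ch K))" for J K
  proof -
    have "sup (ch J) (ch K) = ch (J \<union> K)"
      by (auto simp: ch_def fun_eq_iff sup_nat_def)
    then show ?thesis
      using sup[OF ch ch, of J K] by simp
  qed
  have ch_inf: "g (ch (J \<inter> K)) = min (g (ch J)) (g (ch K))" for J K
  proof -
    have "inf (ch J) (ch K) = ch (J \<inter> K)"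
      by (auto simp: ch_def fun_eq_iff inf_nat_def)
    then show ?thesis
      using inf[OF ch ch, of J K] by simp
  qed
  have mono: "g (ch J) \<le> g (ch K)" if "J \<subseteq> K" for J K
    using ch_sup[of J K] that by (simp add: sup_absorb2 max_def split: if_splits)
  have ch_eq: "ch {i. i < k \<and> x i = 1} = x" if "x \<in> grid 1 k" for x
  proof (rule grid_ext[OF ch that])
    fix i assume "i < k"
    then have "x i \<le> 1"
      using that by (simp add: grid_iff)
    then show "ch {i. i < k \<and> x i = 1} i = x i"
      using \<open>i < k\<close> by (auto simp: ch_def)
  qed
  define p q where "p = g (ch {})" and "q = g (ch {..<k})"
  have bounds: "p \<le> g x" "g x \<le> q" if "x \<in> grid 1 k" for x
    using mono[of "{}" "{i. i < k \<and> x i = 1}"] mono[of "{i. i < k \<and> x i = 1}" "{..<k}"] ch_eq[OF that]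
    by (auto simp: p_def q_def)
  \<comment> \<open>A join of atoms goes to a maximum in a chain, so the value at
    \<open>ch J\<close> is attained at one of its atoms unless it is the bottom value.\<close>
  have *: "g (ch J) = p \<or> (\<exists>i\<in>J. g (ch {i}) = g (ch J))" if "finite J" for J
    using that
  proof (induction J)
    case (insert i J)
    have "g (ch (insert i J)) = max (g (ch {i})) (g (ch J))"
      using ch_sup[of "{i}" J] by simp
    moreover have "p \<le> g (ch {i})"
      using bounds ch by blast
    ultimately show ?case
      using insert by (auto simp: max_def)
  qed (simp add: p_def)
  show ?thesis
  proof (cases "p = q")
    case True
    then show ?thesis
      using bounds by (metis order_antisym)
  next
    case False
    then obtain i where i: "i < k" "g (ch {i}) = q"
      using *[of "{..<k}"] by (auto simp: q_def)
    have "g x = q" if "x \<in> grid 1 k" "x i = 1" for x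
      using mono[of "{i}" "{i. i < k \<and> x i = 1}"] ch_eq[OF that(1)] bounds[OF that(1)] that(2) i by auto
    moreover have "g x = p" if "x \<in> grid 1 k" "x i \<noteq> 1" for x
    proof -
      \<comment> \<open>The atom \<open>i\<close> has the top value \<open>q \<noteq> p\<close>. An
        element disjoint from it meets it in the bottom element, which leaves
        \<open>p = min q (g x)\<close>.\<close>
      have "{i} \<inter> {j. j < k \<and> x j = 1} = {}"
        using that by auto
      then have "p = min q (g x)"
        using ch_inf[of "{i}" "{j. j < k \<and> x j = 1}"] ch_eq[OF that(1)] i by (simp add: p_def)
      then show ?thesis
        using False by (simp add: min_def split: if_splits)
    qed
    moreover have "p \<le> q"
      using bounds ch order_trans by blast
    ultimately show ?thesis
      using i(1) by (intro disjI2 exI[of _ i] conjI exI[of _ p] exI[of _ q]) auto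
  qed
qed

lemma sd2_cell_maps_grid: "a \<in> cells (sd2_cube n) k \<Longrightarrow> a \<in> grid 1 k \<rightarrow>\<^sub>E grid 2 n"
  by (simp add: lattice_cset_def)

text \<open>A coordinate of a cell is a lattice homomorphism into the chain
  \<open>{0, 1, 2}\<close>, hence depends on at most one input, monotonically; halving brings its
  values into \<open>[0,1]\<close>.\<close>

lemma affine_sd2_cell:
  assumes a: "a \<in> cells (sd2_cube n) k"
  shows "affine_cube_map k n (\<lambda>v j. real (a v j) / 2)"
  unfolding affine_cube_map_def
proof (intro allI impI)
  fix j assume j: "j < n"
  have hom: "a (inf x y) = inf (a x) (a y)" "a (sup x y) = sup (a x) (a y)"
    if "x \<in> grid 1 k" "y \<in> grid 1 k" for x y
    using a that by (auto simp: lattice_cset_def)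
  have range: "a x j \<le> 2" if "x \<in> grid 1 k" for x
    using PiE_mem[OF sd2_cell_maps_grid[OF a] that] j by (simp add: grid_iff)
  have z: "(\<lambda>l\<in>{..<k}. 0) \<in> grid 1 k" and o: "(\<lambda>l\<in>{..<k}. 1) \<in> grid 1 k"
    by (simp_all add: grid_iff)
  have "(\<exists>c. \<forall>x\<in>grid 1 k. a x j = c) \<or>
    (\<exists>i<k. \<exists>p q. p \<le> q \<and> (\<forall>x\<in>grid 1 k. a x j = (if x i = 1 then q else p)))"
    by (rule lattice_hom_chain[of k "\<lambda>x. a x j"]) (simp_all add: hom inf_nat_def sup_nat_def)
  then show "\<exists>i p d. coord_affine k (\<lambda>x. real (a x j) / 2) i p d \<and> 0 \<le> d \<and> 0 \<le> p \<and> p + d \<le> 1"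
  proof (elim disjE exE conjE)
    fix c assume c: "\<forall>x\<in>grid 1 k. a x j = c"
    then have "c \<le> 2"
      using range[OF z] z by simp
    then show ?thesis
      using c by (intro exI[of _ 0] exI[of _ "real c / 2"]) (simp add: coord_affine_def)
  next
    fix i p q assume i: "i < k" "p \<le> q" and pq: "\<forall>x\<in>grid 1 k. a x j = (if x i = 1 then q else p)"
    then have "q \<le> 2"
      using range[OF o] o by simp
    moreover have "real (a x j) / 2 = real p / 2 + (real q - real p) / 2 * real (x i)" if x: "x \<in> grid 1 k" for x
    proof (cases "x i = 1")
      case False
      then have "x i = 0"
        using x i by (auto simp: grid_iff le_Suc_eq)
      then show ?thesis
        using pq x by simp
    qed (use pq x in \<open>simp add: field_simps\<close>)
    ultimately show ?thesis
      using i by (intro exI[of _ i] exI[of _ "real p / 2"] exI[of _ "(real q - real p) / 2"])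
        (simp add: coord_affine_def field_simps)
  qed
qed

section \<open>Boolean intervals and morphisms of the cube category\<close>

lemma grid_interval_boolean:
  assumes ab: "a \<in> grid 1 n" "b \<in> grid 1 n" "a \<le> b"
  shows "boolean_interval (grid 1 n) {x \<in> grid 1 n. a \<le> x \<and> x \<le> b}"
proof -
  \<comment> \<open>The interval is a cube on the set \<open>S\<close> of coordinates where its
    endpoints differ; \<open>\<sigma>\<close> numbers these coordinates and \<open>\<tau>\<close>
    inverts the numbering.\<close>
  define S where "S = {i. i < n \<and> a i < b i}"
  have ab_S: "a i = 0" "b i = 1" if "i \<in> S" for i
    using that ab by (force simp: S_def grid_iff)+
  have ab_nS: "a i = b i" if "i < n" "i \<notin> S" for i
    using that ab by (auto simp: S_def le_fun_def le_antisym not_less)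
  have fin: "finite S"
    by (simp add: S_def)
  obtain \<sigma> where \<sigma>: "bij_betw \<sigma> {..<card S} S"
    using ex_bij_betw_nat_finite[OF fin] by (auto simp: atLeast0LessThan)
  define \<tau> where "\<tau> = the_inv_into {..<card S} \<sigma>"
  have \<tau>: "\<tau> i < card S" "\<sigma> (\<tau> i) = i" if "i \<in> S" for i
    using \<sigma> that bij_betwE[OF bij_betw_the_inv_into[OF \<sigma>]] f_the_inv_into_f_bij_betw[OF \<sigma>, of i]
    by (auto simp: \<tau>_def)
  have \<sigma>': "\<sigma> l \<in> S" "\<tau> (\<sigma> l) = l" if "l < card S" for l
    using \<sigma> that bij_betwE[OF \<sigma>] by (auto simp: \<tau>_def bij_betw_def the_inv_into_f_f)
  define h where "h y = (\<lambda>i\<in>{..<n}. if i \<in> S then y (\<tau> i) else a i)" for y :: vertex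
  have S_less: "i < n" if "i \<in> S" for i
    using that by (simp add: S_def)
  have h_range: "h y \<in> {x \<in> grid 1 n. a \<le> x \<and> x \<le> b}" if y: "y \<in> grid 1 (card S)" for y
  proof -
    have "a i \<le> h y i \<and> h y i \<le> b i" for i
    proof (cases "i < n")
      case True
      then show ?thesis
        using ab_S[of i] ab_nS[of i] \<tau>[of i] y by (auto simp: h_def grid_iff)
    next
      case False
      then show ?thesis
        using ab by (simp add: h_def grid_iff extensional_def)
    qed
    moreover have "h y \<in> grid 1 n"
      using ab y \<tau>(1) by (auto simp: h_def grid_iff)
    ultimately show ?thesis
      by (simp add: le_fun_def)
  qed
  have h_le: "y \<le> z" if "y \<in> grid 1 (card S)" "z \<in> grid 1 (card S)" "h y \<le> h z" for y z
    unfolding le_fun_def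
  proof
    fix l
    show "y l \<le> z l"
    proof (cases "l < card S")
      case True
      have "h y (\<sigma> l) \<le> h z (\<sigma> l)"
        using that(3) by (simp add: le_fun_def)
      then show ?thesis
        using \<sigma>'[OF True] S_less by (simp add: h_def)
    next
      case False
      then show ?thesis
        using that by (simp add: grid_iff extensional_def)
    qed
  qed
  have h_mono: "h y \<le> h z" if "y \<le> z" for y z
    using that by (auto simp: h_def le_fun_def)
  have "\<exists>y\<in>grid 1 (card S). h y = x" if x: "x \<in> grid 1 n" "a \<le> x" "x \<le> b" for x
  proof
    show "(\<lambda>l\<in>{..<card S}. x (\<sigma> l)) \<in> grid 1 (card S)"
      using x(1) \<sigma>'(1) S_less by (auto simp: grid_iff)
    have "x i = a i" if "i < n" "i \<notin> S" for i
      using x ab_nS[OF that] by (metis le_funD order_antisym)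
    then show "h (\<lambda>l\<in>{..<card S}. x (\<sigma> l)) = x"
      using x(1) \<tau> by (auto simp: h_def fun_eq_iff grid_iff extensional_def)
  qed
  then have "h ` grid 1 (card S) = {x \<in> grid 1 n. a \<le> x \<and> x \<le> b}"
    using h_range by (auto simp: image_iff)
  moreover have "inj_on h (grid 1 (card S))"
    using h_le by (intro inj_onI order_antisym) auto
  ultimately have "bij_betw h (grid 1 (card S)) {x \<in> grid 1 n. a \<le> x \<and> x \<le> b}"
    by (simp add: bij_betw_def)
  then show ?thesis
    unfolding boolean_interval_def using ab h_le h_mono by blast
qed

lemma box_mono:
  assumes "box m n f" "x \<in> grid 1 m" "y \<in> grid 1 m" "x \<le> y"
  shows "f x \<le> f y"
  unfolding le_fun_def
proof
  fix j
  show "f x j \<le> f y j"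
  proof (cases "j < n")
    case True
    then show ?thesis
      using box_coordinate[OF assms(1) True] assms(2-) by (auto simp: le_fun_def)
  next
    case False
    then show ?thesis
      using PiE_mem[OF box_maps_grid[OF assms(1)] assms(2)] PiE_mem[OF box_maps_grid[OF assms(1)] assms(3)]
      by (simp add: grid_iff extensional_def)
  qed
qed

lemma inf_grid: "x \<in> grid k n \<Longrightarrow> y \<in> grid k n \<Longrightarrow> inf x y \<in> grid k n"
  by (auto simp: grid_iff extensional_def inf_nat_def)

lemma sup_grid: "x \<in> grid k n \<Longrightarrow> y \<in> grid k n \<Longrightarrow> sup x y \<in> grid k n"
  by (auto simp: grid_iff extensional_def sup_nat_def)

lemma box_inf_sup:
  assumes f: "box m n f" and xy: "x \<in> grid 1 m" "y \<in> grid 1 m"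
  shows "f (inf x y) = inf (f x) (f y)" "f (sup x y) = sup (f x) (f y)"
proof -
  have g: "f z \<in> grid 1 n" if "z \<in> grid 1 m" for z
    using PiE_mem[OF box_maps_grid[OF f] that] .
  show "f (inf x y) = inf (f x) (f y)"
    using box_coordinate[OF f] inf_grid[OF xy] xy
    by (intro grid_ext[OF g inf_grid[OF g g]]) fastforce+
  show "f (sup x y) = sup (f x) (f y)"
    using box_coordinate[OF f] sup_grid[OF xy] xy
    by (intro grid_ext[OF g sup_grid[OF g g]]) fastforce+
qed

text \<open>Here the absence of diagonals counts: a diagonal is monotone but misses points between
  its end values. The proof therefore returns to the generators and gives a preimage for
  each.\<close>

lemma box_interval_image:
  assumes "box m n f" "a \<in> grid 1 m" "b \<in> grid 1 m" "a \<le> b"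
  shows "f ` {x \<in> grid 1 m. a \<le> x \<and> x \<le> b} = {y \<in> grid 1 n. f a \<le> y \<and> y \<le> f b}"
proof
  show "f ` {x \<in> grid 1 m. a \<le> x \<and> x \<le> b} \<subseteq> {y \<in> grid 1 n. f a \<le> y \<and> y \<le> f b}"
    using box_mono[OF assms(1)] assms(2,3) box_maps_grid[OF assms(1)] by auto
  have "\<exists>x\<in>grid 1 m. a \<le> x \<and> x \<le> b \<and> f x = y"
    if "y \<in> grid 1 n" "f a \<le> y" "y \<le> f b" for y
    using assms that
  proof (induction arbitrary: a b y rule: box.induct)
    case (box_ident n)
    then show ?case
      by (auto simp: box_id_def)
  next
    case (box_coface i n e)
    \<comment> \<open>The coordinate \<open>y i\<close> is squeezed between two copies of
      \<open>e\<close>, so dropping it loses nothing.\<close>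
    define x where "x = (\<lambda>j\<in>{..<n}. y (if j < i then j else Suc j))"
    have y: "coface n i e a j \<le> y j" "y j \<le> coface n i e b j" for j
      using box_coface.prems by (auto simp: le_fun_def)
    have x: "x \<in> grid 1 n"
      using box_coface.prems by (auto simp: x_def grid_iff)
    have "a j \<le> x j \<and> x j \<le> b j" for j
      using y[of "if j < i then j else Suc j"] box_coface.prems
      by (cases "j < n") (auto simp: coface_def x_def grid_iff extensional_def split: if_splits)
    moreover have "coface n i e x j = y j" for j
      using y[of j] box_coface.prems x
      by (cases "j < Suc n") (auto simp: coface_def x_def grid_iff extensional_def split: if_splits)
    ultimately show ?case
      using x by (intro bexI[of _ x]) (auto simp: le_fun_def)
  next
    case (box_codegeneracy i n)
    \<comment> \<open>The coordinate that the codegeneracy omits can be any value between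
      \<open>a i\<close> and \<open>b i\<close>; \<open>a i\<close> is taken.\<close>
    define x where "x = (\<lambda>j\<in>{..<Suc n}. if j < i then y j else if j = i then a i else y (j - 1))"
    have y: "codegeneracy n i a j \<le> y j" "y j \<le> codegeneracy n i b j" for j
      using box_codegeneracy.prems by (auto simp: le_fun_def)
    have x: "x \<in> grid 1 (Suc n)"
      using box_codegeneracy.prems box_codegeneracy.hyps by (auto simp: x_def grid_iff)
    have ab: "a j \<le> b j" for j
      using box_codegeneracy.prems by (auto simp: le_fun_def)
    have "a j \<le> x j \<and> x j \<le> b j" for j
      using y[of "if j < i then j else j - 1"] box_codegeneracy.prems box_codegeneracy.hyps ab[of j]
      by (cases "j < Suc n") (auto simp: codegeneracy_def x_def grid_iff extensional_def split: if_splits)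
    moreover have "codegeneracy n i x = y"
    proof (rule ext)
      fix j
      show "codegeneracy n i x j = y j"
        using box_codegeneracy.prems box_codegeneracy.hyps x
        by (cases "j < n") (auto simp: codegeneracy_def x_def grid_iff extensional_def split: if_splits)
    qed
    ultimately show ?case
      using x by (intro bexI[of _ x]) (auto simp: le_fun_def)
  next
    case (box_permutation p n)
    note p = box_permutation.hyps
    have p_less: "p j < n \<longleftrightarrow> j < n" "inv p j < n \<longleftrightarrow> j < n" for j
      using permutes_in_image[OF p, of j] permutes_in_image[OF permutes_inv[OF p], of j] by auto
    define x where "x = (\<lambda>j\<in>{..<n}. y (inv p j))"
    have y: "coordinate_permutation n p a j \<le> y j" "y j \<le> coordinate_permutation n p b j" for j
      using box_permutation.prems by (auto simp: le_fun_def)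
    have x: "x \<in> grid 1 n"
      using box_permutation.prems p_less by (auto simp: x_def grid_iff)
    have "a j \<le> x j \<and> x j \<le> b j" for j
      using y[of "inv p j"] box_permutation.prems p_less permutes_inverses[OF p]
      by (cases "j < n") (auto simp: coordinate_permutation_def x_def grid_iff extensional_def)
    moreover have "coordinate_permutation n p x = y"
      using box_permutation.prems x p_less permutes_inverses[OF p]
      by (auto simp: coordinate_permutation_def x_def fun_eq_iff grid_iff extensional_def)
    ultimately show ?case
      using x by (intro bexI[of _ x]) (auto simp: le_fun_def)
  next
    case (box_compose l m g n f)
    have g: "g a \<in> grid 1 m" "g b \<in> grid 1 m" "g a \<le> g b"
      using box_compose.prems box_mono[OF box_compose.hyps(1)] box_maps_grid[OF box_compose.hyps(1)] by auto
    obtain z where z: "z \<in> grid 1 m" "g a \<le> z" "z \<le> g b" "f z = y"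
      using box_compose.IH(2)[OF g, of y] box_compose.prems by (auto simp: compose_def)
    obtain x where "x \<in> grid 1 l" "a \<le> x" "x \<le> b" "g x = z"
      using box_compose.IH(1)[OF _ _ _ z(1-3)] box_compose.prems by auto
    then show ?case
      using z by (intro bexI[of _ x]) (auto simp: compose_def)
  qed
  then show "{y \<in> grid 1 n. f a \<le> y \<and> y \<le> f b} \<subseteq> f ` {x \<in> grid 1 m. a \<le> x \<and> x \<le> b}"
    by blast
qed

lemma box_boolean_interval:
  assumes f: "box m n f" and "boolean_interval (grid 1 m) B"
  shows "boolean_interval (grid 1 n) (f ` B)"
proof -
  obtain a b where ab: "a \<in> grid 1 m" "b \<in> grid 1 m" "a \<le> b" "B = {x \<in> grid 1 m. a \<le> x \<and> x \<le> b}"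
    using assms(2) by (auto simp: boolean_interval_def)
  show ?thesis
    unfolding ab(4) box_interval_image[OF f ab(1-3)]
    using box_mono[OF f ab(1-3)] box_maps_grid[OF f] ab(1,2) by (intro grid_interval_boolean) auto
qed

lemma sd2_cube_act:
  assumes f: "box m k f" and a: "a \<in> cells (sd2_cube n) k"
  shows "compose (grid 1 m) a f \<in> cells (sd2_cube n) m"
proof -
  have f_grid: "f x \<in> grid 1 k" if "x \<in> grid 1 m" for x
    using PiE_mem[OF box_maps_grid[OF f] that] .
  have img: "compose (grid 1 m) a f ` B = a ` f ` B" if "boolean_interval (grid 1 m) B" for B
    using that by (auto simp: boolean_interval_def compose_def image_image intro!: image_cong)
  have "compose (grid 1 m) a f \<in> grid 1 m \<rightarrow>\<^sub>E grid 2 n"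
    using sd2_cell_maps_grid[OF a] f_grid by (auto simp: compose_def)
  moreover have "compose (grid 1 m) a f (inf x y) = inf (compose (grid 1 m) a f x) (compose (grid 1 m) a f y) \<and>
      compose (grid 1 m) a f (sup x y) = sup (compose (grid 1 m) a f x) (compose (grid 1 m) a f y)"
    if "x \<in> grid 1 m" "y \<in> grid 1 m" for x y
    using a that f_grid box_inf_sup[OF f that] inf_grid[OF that] sup_grid[OF that]
    by (simp add: compose_def lattice_cset_def)
  moreover have "boolean_interval (grid 2 n) (compose (grid 1 m) a f ` B)" if "boolean_interval (grid 1 m) B" for B
    unfolding img[OF that] using a box_boolean_interval[OF f that] by (simp add: lattice_cset_def)
  ultimately show ?thesis
    by (simp add: lattice_cset_def)
qed

section \<open>The top-dimensional cells of the subdivided cube\<close>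

definition subcell :: "nat \<Rightarrow> vertex \<Rightarrow> vertex \<Rightarrow> vertex" where
  "subcell n w = (\<lambda>x\<in>grid 1 n. \<lambda>i\<in>{..<n}. x i + w i)"

text \<open>Translation by \<open>w\<close> is an order isomorphism of \<open>[1]^n\<close> onto an
  interval of \<open>[2]^n\<close>, so it carries intervals to intervals and preserves their Boolean
  shape.\<close>

lemma subcell_cell:
  assumes w: "w \<in> grid 1 n"
  shows "subcell n w \<in> cells (sd2_cube n) n"
proof -
  have sub_grid: "subcell n w x \<in> grid 2 n" if "x \<in> grid 1 n" for x
    using that w by (force simp: subcell_def grid_iff)
  have le_iff: "subcell n w x \<le> subcell n w y \<longleftrightarrow> x \<le> y" if "x \<in> grid 1 n" "y \<in> grid 1 n" for x y
  proof -
    have "x i \<le> y i \<longleftrightarrow> subcell n w x i \<le> subcell n w y i" for i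
      using that by (cases "i < n") (auto simp: subcell_def grid_iff extensional_def)
    then show ?thesis
      by (simp add: le_fun_def)
  qed
  have "subcell n w \<in> grid 1 n \<rightarrow>\<^sub>E grid 2 n"
    using sub_grid by (auto simp: subcell_def)
  moreover have "subcell n w (inf x y) = inf (subcell n w x) (subcell n w y) \<and>
      subcell n w (sup x y) = sup (subcell n w x) (subcell n w y)"
    if "x \<in> grid 1 n" "y \<in> grid 1 n" for x y
    using that inf_grid[OF that] sup_grid[OF that]
    by (auto simp: subcell_def fun_eq_iff inf_nat_def sup_nat_def)
  moreover have "boolean_interval (grid 2 n) (subcell n w ` B)" if B: "boolean_interval (grid 1 n) B" for B
  proof -
    obtain a b where ab: "a \<in> grid 1 n" "b \<in> grid 1 n" "a \<le> b" "B = {x \<in> grid 1 n. a \<le> x \<and> x \<le> b}"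
      using B by (auto simp: boolean_interval_def)
    obtain m h where h: "bij_betw h (grid 1 m) B"
      "\<And>x y. x \<in> grid 1 m \<Longrightarrow> y \<in> grid 1 m \<Longrightarrow> x \<le> y \<longleftrightarrow> h x \<le> h y"
      using B by (auto simp: boolean_interval_def)
    have "subcell n w ` B = {x \<in> grid 2 n. subcell n w a \<le> x \<and> x \<le> subcell n w b}"
    proof (intro equalityI subsetI)
      fix y assume y: "y \<in> {x \<in> grid 2 n. subcell n w a \<le> x \<and> x \<le> subcell n w b}"
      \<comment> \<open>The subtraction of natural numbers is exact, since
        \<open>y i \<ge> a i + w i\<close>.\<close>
      define x where "x = (\<lambda>i\<in>{..<n}. y i - w i)"
      have yi: "a i + w i \<le> y i" "y i \<le> b i + w i" if "i < n" for i
        using y that ab by (auto simp: subcell_def le_fun_def dest!: spec[of _ i])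
      have bi: "b i \<le> 1" if "i < n" for i
        using ab that by (simp add: grid_iff)
      have x: "x \<in> grid 1 n"
        unfolding grid_iff
      proof (intro conjI allI impI)
        show "x i \<le> 1" if "i < n" for i
          using yi[OF that] bi[OF that] that by (simp add: x_def)
      qed (simp add: x_def)
      have "subcell n w x = y"
        by (rule grid_ext[OF sub_grid[OF x], of _ 2]) (use y x yi in \<open>force simp: subcell_def x_def\<close>)+
      then show "y \<in> subcell n w ` B"
        using y x ab le_iff[of a x] le_iff[of x b] by (auto simp: image_iff)
    qed (use ab le_iff sub_grid in auto)
    then have "\<exists>a'\<in>grid 2 n. \<exists>b'\<in>grid 2 n. a' \<le> b' \<and> subcell n w ` B = {x \<in> grid 2 n. a' \<le> x \<and> x \<le> b'}"
      using ab sub_grid le_iff[of a b] by (intro bexI[of _ "subcell n w a"] bexI[of _ "subcell n w b"]) simp_all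
    moreover have "inj_on (subcell n w) B"
      unfolding ab(4) by (intro inj_onI order_antisym) (auto simp flip: le_iff)
    then have "bij_betw (\<lambda>x. subcell n w (h x)) (grid 1 m) (subcell n w ` B)"
      using bij_betw_trans[OF h(1) inj_on_imp_bij_betw] by (simp add: o_def)
    moreover have "\<forall>x\<in>grid 1 m. \<forall>y\<in>grid 1 m. x \<le> y \<longleftrightarrow> subcell n w (h x) \<le> subcell n w (h y)"
      using h(2) le_iff bij_betwE[OF h(1)] ab by auto
    ultimately show ?thesis
      unfolding boolean_interval_def by blast
  qed
  ultimately show ?thesis
    by (simp add: lattice_cset_def)
qed


section \<open>Realization of the subdivided cube\<close>

text \<open>The topology of \<open>glue\<close> is given through the constructor
  \<open>topology\<close>, so its open sets can be read off only after the intended ones are shown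
  to be closed under unions and binary intersections.\<close>

lemma openin_glue:
  "openin (space_of (glue I D E)) U \<longleftrightarrow> U \<subseteq> coproduct_pts I D // E \<and>
     (\<forall>i\<in>I. openin (space_of (D i)) {x \<in> pts (D i). E `` {(i, x)} \<in> U})"
proof -
  define opn where "opn = (\<lambda>U. U \<subseteq> coproduct_pts I D // E \<and>
     (\<forall>i\<in>I. openin (space_of (D i)) {x \<in> pts (D i). E `` {(i, x)} \<in> U}))"
  have "istopology opn"
    unfolding istopology_def
  proof (intro conjI allI impI)
    fix S T assume "opn S" "opn T"
    moreover have "{x \<in> pts (D i). E `` {(i, x)} \<in> S \<inter> T} =
        {x \<in> pts (D i). E `` {(i, x)} \<in> S} \<inter> {x \<in> pts (D i). E `` {(i, x)} \<in> T}" for i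
      by auto
    ultimately show "opn (S \<inter> T)"
      by (auto simp: opn_def)
  next
    fix \<K> assume "\<forall>K\<in>\<K>. opn K"
    moreover have "{x \<in> pts (D i). E `` {(i, x)} \<in> \<Union>\<K>} =
        (\<Union>K\<in>\<K>. {x \<in> pts (D i). E `` {(i, x)} \<in> K})" for i
      by auto
    ultimately show "opn (\<Union>\<K>)"
      by (auto simp: opn_def)
  qed
  then have "openin (topology opn) = opn"
    by (rule topology_inverse')
  then show ?thesis
    by (simp add: glue_def opn_def)
qed

lemma pts_glue: "pts (glue I D E) = coproduct_pts I D // E"
proof
  show "pts (glue I D E) \<subseteq> coproduct_pts I D // E"
    using openin_topspace[of "space_of (glue I D E)"] unfolding openin_glue by simp
  have "{x \<in> pts (D i). E `` {(i, x)} \<in> coproduct_pts I D // E} = pts (D i)" if "i \<in> I" for i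
    using that by (auto simp: coproduct_pts_def intro!: quotientI)
  then have "openin (space_of (glue I D E)) (coproduct_pts I D // E)"
    by (simp add: openin_glue)
  then show "coproduct_pts I D // E \<subseteq> pts (glue I D E)"
    by (rule openin_subset)
qed

lemma Hausdorff_imp_weak_Hausdorff: "Hausdorff_space T \<Longrightarrow> weak_Hausdorff T"
  unfolding weak_Hausdorff_def
  by (metis compactin_imp_closedin compact_space_def image_compactin)

text \<open>
  A cocone with Hausdorff vertex factors through the colimit: gluing along its kernel gives a
  space that injects continuously into the vertex.
\<close>

lemma ditop_rel_kernel:
  assumes T: "Hausdorff_space T"
    and cont: "\<And>i. i \<in> I \<Longrightarrow> continuous_map (space_of (D i)) T (\<psi> i)"
    and arrows: "\<And>i j f x. (i, j, f) \<in> A \<Longrightarrow> x \<in> pts (D i) \<Longrightarrow>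
      i \<in> I \<and> j \<in> I \<and> f x \<in> pts (D j) \<and> \<psi> j (f x) = \<psi> i x"
    and rel: "((i, x), (j, y)) \<in> ditop_rel I D A"
  shows "\<psi> i x = \<psi> j y"
proof -
  define \<Psi> where "\<Psi> = (\<lambda>(i, x). \<psi> i x)"
  define E where "E = {(p, q). p \<in> coproduct_pts I D \<and> q \<in> coproduct_pts I D \<and> \<Psi> p = \<Psi> q}"
  have E: "equiv (coproduct_pts I D) E"
    by (rule equivI) (auto simp: E_def refl_on_def sym_def trans_def)
  have "arrow_rel D A \<subseteq> E"
    using arrows by (fastforce simp: arrow_rel_def E_def coproduct_pts_def \<Psi>_def)
  moreover have "Hausdorff_space (space_of (glue I D E))"
  proof -
    \<comment> \<open>The map induced by \<open>\<Psi>\<close> on classes. The chosen representative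
      is immaterial because \<open>E\<close> is the kernel of \<open>\<Psi>\<close>, and for the
      same reason \<open>F\<close> is injective.\<close>
    define F where "F P = \<Psi> (SOME p. p \<in> P)" for P
    have F: "F (E `` {p}) = \<Psi> p" if "p \<in> coproduct_pts I D" for p
    proof -
      have "(SOME q. q \<in> E `` {p}) \<in> E `` {p}"
        using that by (intro someI_ex[of "\<lambda>q. q \<in> E `` {p}"] exI[of _ p]) (simp add: E_def)
      then have "\<Psi> p = \<Psi> (SOME q. q \<in> E `` {p})"
        unfolding Image_singleton_iff using E_def by blast
      then show ?thesis
        by (simp only: F_def)
    qed
    have inj: "inj_on F (pts (glue I D E))"
    proof (rule inj_onI)
      fix P Q assume PQ: "P \<in> pts (glue I D E)" "Q \<in> pts (glue I D E)" "F P = F Q"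
      then obtain p q where pq: "p \<in> coproduct_pts I D" "q \<in> coproduct_pts I D" "P = E `` {p}" "Q = E `` {q}"
        unfolding pts_glue by (auto elim!: quotientE)
      then have "(p, q) \<in> E"
        using PQ(3) F by (simp add: E_def)
      then show "P = Q"
        using equiv_class_eq[OF E] pq by simp
    qed
    have "continuous_map (space_of (glue I D E)) T F"
      unfolding continuous_map_def
    proof (intro conjI allI impI)
      have "\<psi> i x \<in> topspace T" if "i \<in> I" "x \<in> pts (D i)" for i x
        using continuous_map_funspace[OF cont[OF that(1)]] that(2) by auto
      then have "\<Psi> p \<in> topspace T" if "p \<in> coproduct_pts I D" for p
        using that by (auto simp: coproduct_pts_def \<Psi>_def)
      then show "F \<in> pts (glue I D E) \<rightarrow> topspace T"
        using F unfolding pts_glue by (auto elim!: quotientE)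
      fix V assume V: "openin T V"
      have "{x \<in> pts (D i). E `` {(i, x)} \<in> {P \<in> pts (glue I D E). F P \<in> V}} = {x \<in> pts (D i). \<psi> i x \<in> V}"
        if "i \<in> I" for i
        using that F[of "(i, _)"]
        by (auto simp: pts_glue coproduct_pts_def \<Psi>_def intro!: quotientI)
      then show "openin (space_of (glue I D E)) {P \<in> pts (glue I D E). F P \<in> V}"
        unfolding openin_glue using openin_continuous_map_preimage[OF cont V] by (auto simp: pts_glue)
    qed
    then show ?thesis
      using Hausdorff_space_injective_preimage[OF T _ inj] by blast
  qed
  ultimately have "ditop_rel I D A \<subseteq> E"
    using E Hausdorff_imp_weak_Hausdorff unfolding ditop_rel_def by (intro Inter_lower) simp
  then show ?thesis
    using rel by (auto simp: E_def \<Psi>_def)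
qed

lemma ditop_rel_refl: "p \<in> coproduct_pts I D \<Longrightarrow> (p, p) \<in> ditop_rel I D A"
  by (auto simp: ditop_rel_def equiv_def refl_on_def)

lemma the_elem_image:
  assumes "p \<in> P" "\<And>q. q \<in> P \<Longrightarrow> F q = F p"
  shows "the_elem (F ` P) = F p"
proof -
  have "F ` P = {F p}"
    using assms(1) by (auto dest: assms(2))
  then show ?thesis
    by simp
qed

section \<open>The affine maps from the cells to the cube\<close>

definition half_affine :: "nat \<Rightarrow> nat \<Rightarrow> (vertex \<Rightarrow> vertex) \<Rightarrow> point \<Rightarrow> point" where
  "half_affine k n a = affine_ext k n (\<lambda>v j. real (a v j) / 2)"

lemma half_affine_stream_hom: "a \<in> cells (sd2_cube n) k \<Longrightarrow> half_affine k n a \<in> stream_hom (dcube k) (dcube n)"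
  unfolding half_affine_def by (intro affine_ext_stream_hom affine_sd2_cell)

lemma half_affine_act:
  assumes "box m k f" "a \<in> cells (sd2_cube n) k" "t \<in> pts (dcube m)"
  shows "half_affine m n (compose (grid 1 m) a f) t = half_affine k n a (box_real m k f t)"
  unfolding half_affine_def
  using affine_ext_compose[OF assms(1) affine_sd2_cell[OF assms(2)] assms(3)]
  by (simp add: compose_def)

lemma Hausdorff_cube: "Hausdorff_space (cube_topology n)"
  unfolding cube_topology_def Hausdorff_space_product_topology
  by (simp add: Hausdorff_space_subtopology)

text \<open>The maps \<open>half_affine k n a\<close> form a cocone on the cells of the subdivided
  cube with the Hausdorff cube as vertex. They are therefore constant on the classes of the
  realization, so that \<open>the_elem\<close> in \<open>phi2\<close> is applied to a
  singleton.\<close>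

lemma phi2_cell_map:
  assumes a: "a \<in> cells (sd2_cube n) k" and t: "t \<in> pts (dcube k)"
  shows "cell_map (sd2_cube n) k a t \<in> pts (realization (sd2_cube n))"
    and "phi2 n (cell_map (sd2_cube n) k a t) = half_affine k n a t"
proof -
  define I where "I = elements (sd2_cube n)"
  define D :: "nat \<times> (vertex \<Rightarrow> vertex) \<Rightarrow> point stream" where "D = (\<lambda>(n, c). dcube n)"
  define A where "A = element_arrows (sd2_cube n)"
  define \<psi> where "\<psi> = (\<lambda>(k, a). half_affine k n a)"
  define p where "p = ((k, a), t)"
  have p: "p \<in> coproduct_pts I D"
    using a t by (simp add: p_def coproduct_pts_def I_def D_def elements_def)
  have P: "cell_map (sd2_cube n) k a t = ditop_rel I D A `` {p}"
    using t by (simp add: cell_map_def I_def D_def A_def p_def)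
  show R: "cell_map (sd2_cube n) k a t \<in> pts (realization (sd2_cube n))"
    using p unfolding P realization_def ditop_colimit_def I_def[symmetric] D_def[symmetric] A_def[symmetric] pts_glue
    by (rule quotientI)
  have rel: "\<psi> i x = \<psi> j y" if "((i, x), (j, y)) \<in> ditop_rel I D A" for i x j y
  proof (rule ditop_rel_kernel[OF Hausdorff_cube _ _ that])
    show "continuous_map (space_of (D i)) (cube_topology n) (\<psi> i)" if "i \<in> I" for i
      using that half_affine_stream_hom
      by (auto simp: I_def elements_def D_def \<psi>_def stream_hom_def stream_map_def space_of_dcube)
    show "i \<in> I \<and> j \<in> I \<and> f x \<in> pts (D j) \<and> \<psi> j (f x) = \<psi> i x"
      if "(i, j, f) \<in> A" "x \<in> pts (D i)" for i j f x
    proof -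
      obtain m k g b where g: "box m k g" "b \<in> cells (sd2_cube n) k"
        "i = (m, compose (grid 1 m) b g)" "j = (k, b)" "f = box_real m k g"
        using \<open>(i, j, f) \<in> A\<close> by (auto simp: A_def element_arrows_def lattice_cset_def)
      then show ?thesis
        using that(2) sd2_cube_act[OF g(1,2)] half_affine_act[OF g(1,2)] box_real_pts[OF g(1)]
        by (simp add: I_def elements_def D_def \<psi>_def)
    qed
  qed
  define F where "F = (\<lambda>((k, a), t). affine_ext k n (\<lambda>v j. real (a v j :: nat) / 2) t)"
  have F: "F q = \<psi> (fst q) (snd q)" for q
    by (simp add: F_def \<psi>_def half_affine_def split: prod.split)
  have "the_elem (F ` (ditop_rel I D A `` {p})) = F p"
  proof (rule the_elem_image)
    show "p \<in> ditop_rel I D A `` {p}"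
      using ditop_rel_refl[OF p] by blast
    fix q assume "q \<in> ditop_rel I D A `` {p}"
    then have "((fst p, snd p), (fst q, snd q)) \<in> ditop_rel I D A"
      by simp
    then show "F q = F p"
      unfolding F by (rule rel[symmetric])
  qed
  then show "phi2 n (cell_map (sd2_cube n) k a t) = half_affine k n a t"
    using R unfolding P by (simp add: phi2_def flip: F_def) (simp add: F p_def \<psi>_def)
qed

text \<open>This eliminates the realization: from here on the cells of \<open>phi_sharp_cube\<close>
  are plain composites of maps between directed cubes.\<close>

lemma phi_sharp_cube_eq:
  assumes "a \<in> cells (sd2_cube m) k"
  shows "phi_sharp_cube m h k a = compose (pts (dcube k)) h (half_affine k m a)"
  using assms phi2_cell_map[OF assms]
  by (simp add: phi_sharp_cube_def adjunct_def compose_def restrict_def cong: if_cong)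


section \<open>The structure map from the sharp construction\<close>

lemma cells_sing: "cells (sing X) n = stream_hom (dcube n) X"
  by (simp add: sing_def)

lemma act_sing: "act (sing X) m n f h = compose (pts (dcube m)) h (box_real m n f)"
  by (simp add: sing_def)

lemma compose_dcube_hom:
  "f \<in> stream_hom (dcube m) Y \<Longrightarrow> g \<in> stream_hom Y Z \<Longrightarrow> compose (pts (dcube m)) g f \<in> stream_hom (dcube m) Z"
  using compose_stream_hom[OF stream_dcube] .

lemma stream_hom_pts: "f \<in> stream_hom X Y \<Longrightarrow> x \<in> pts X \<Longrightarrow> f x \<in> pts Y"
  using stream_map_pts[of X Y f x] by (simp add: stream_hom_def)

lemma compose_dcube_assoc:
  assumes "f \<in> stream_hom (dcube l) (dcube m)"
  shows "compose (pts (dcube l)) (compose (pts (dcube m)) h g) f =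
    compose (pts (dcube l)) h (compose (pts (dcube l)) g f)"
  using stream_hom_pts[OF assms] by (simp add: compose_def cong: restrict_cong)

lemma act_sing_compose:
  assumes "box l m g" "box m n f"
  shows "act (sing X) l m g (act (sing X) m n f c) = act (sing X) l n (compose (grid 1 l) f g) c"
  using box_real_pts[OF assms(1)] box_real_compose[OF assms]
  by (simp add: act_sing compose_def cong: restrict_cong)

lemma cubical_set_sing: "cubical_set (sing X)"
  unfolding cubical_set_def
proof (intro conjI allI impI ballI; (elim conjE)?)
  show "act (sing X) m n f c \<in> cells (sing X) m" if "box m n f" "c \<in> cells (sing X) n" for m n f c
    using compose_dcube_hom[OF box_real_stream_hom[OF that(1)]] that(2) by (simp add: cells_sing act_sing)
  show "act (sing X) n n (box_id n) c = c" if "c \<in> cells (sing X) n" for n c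
  proof (rule extensionalityI[of _ "pts (dcube n)"])
    show "act (sing X) n n (box_id n) c x = c x" if "x \<in> pts (dcube n)" for x
      using that by (simp add: act_sing compose_def box_real_id)
  qed (use that in \<open>auto simp: act_sing compose_def cells_sing stream_hom_def\<close>)
  show "act (sing X) l m g (act (sing X) m n f c) = act (sing X) l n (compose (grid 1 l) f g) c"
    if "box l m g" "box m n f" for l m n g f c
    using act_sing_compose[OF that] .
qed

lemma cubical_map_sing_map:
  assumes "g \<in> stream_hom X Y"
  shows "cubical_map (sing X) (sing Y) (sing_map g)"
  unfolding cubical_map_def
proof (intro conjI allI impI ballI; (elim conjE)?)
  show "sing_map g n c \<in> cells (sing Y) n" if "c \<in> cells (sing X) n" for n c
    using that compose_dcube_hom[OF _ assms] by (simp add: cells_sing sing_map_def)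
  show "sing_map g m (act (sing X) m n f c) = act (sing Y) m n f (sing_map g n c)" if "box m n f" for m n f c
    using box_real_pts[OF that] by (simp add: act_sing sing_map_def compose_def cong: restrict_cong)
qed

section \<open>Functions on the coend\<close>

lemma sharp_triples_iff:
  "(n, c, h) \<in> sharp_triples C m \<longleftrightarrow> c \<in> cells C n \<and> h \<in> stream_hom (dcube m) (dcube n)"
  by (simp add: sharp_triples_def cells_sing)

lemma sharp_triples_act:
  assumes "cubical_set C" "box k n f" "c \<in> cells C n" "h \<in> stream_hom (dcube m) (dcube k)"
  shows "(k, act C k n f c, h) \<in> sharp_triples C m"
    and "(n, c, sing_map (box_real k n f) m h) \<in> sharp_triples C m"
  using assms compose_dcube_hom[OF assms(4) box_real_stream_hom[OF assms(2)]]
  unfolding sharp_triples_iff cubical_set_def sing_map_def by blast+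

lemma sharp_class_act:
  assumes "box k n f" "c \<in> cells C n" "h \<in> stream_hom (dcube m) (dcube k)"
  shows "sharp_class C m (k, act C k n f c, h) = sharp_class C m (n, c, sing_map (box_real k n f) m h)"
proof -
  define p q where "p = (k, act C k n f c, h)" and "q = (n, c, sing_map (box_real k n f) m h)"
  have "sym (sharp_rel C m)"
  proof (rule symI)
    fix p q assume "(p, q) \<in> sharp_rel C m"
    then show "(q, p) \<in> sharp_rel C m"
      unfolding sharp_rel_def by (auto simp: equiv_def intro: symD)
  qed
  moreover have "trans (sharp_rel C m)"
  proof (rule transI)
    fix p q r assume "(p, q) \<in> sharp_rel C m" "(q, r) \<in> sharp_rel C m"
    then show "(p, r) \<in> sharp_rel C m"
      unfolding sharp_rel_def by (auto simp: equiv_def intro: transD)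
  qed
  moreover have "(p, q) \<in> sharp_rel C m"
    unfolding sharp_rel_def p_def q_def cells_sing using assms by blast
  ultimately show ?thesis
    unfolding sharp_class_def p_def[symmetric] q_def[symmetric]
    by (auto dest: symD transD)
qed

text \<open>The universal property of the coend: the kernel of \<open>F\<close> on triples is one of
  the relations intersected in \<open>sharp_rel\<close>, so \<open>F\<close> is constant on each
  class. The action, \<rho>, the induced maps and \<open>phi_sharp\<close> are all computed this
  way.\<close>

lemma the_elem_sharp_class:
  assumes C: "cubical_set C"
    and F: "\<And>k n f c h. box k n f \<Longrightarrow> c \<in> cells C n \<Longrightarrow> h \<in> stream_hom (dcube m) (dcube k) \<Longrightarrow>
      F (k, act C k n f c, h) = F (n, c, sing_map (box_real k n f) m h)"
    and p: "p \<in> sharp_triples C m"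
  shows "the_elem (F ` sharp_class C m p) = F p"
proof -
  define E where "E = {(p, q). p \<in> sharp_triples C m \<and> q \<in> sharp_triples C m \<and> F p = F q}"
  have "equiv (sharp_triples C m) E"
    by (rule equivI) (auto simp: E_def refl_on_def sym_def trans_def)
  moreover have "{((k, act C k n f c, h), (n, c, sing_map (box_real k n f) m h)) | k n f c h.
     box k n f \<and> c \<in> cells C n \<and> h \<in> cells (sing (dcube k)) m} \<subseteq> E"
    using F sharp_triples_act[OF C] by (auto simp: E_def cells_sing)
  ultimately have "sharp_rel C m \<subseteq> E"
    unfolding sharp_rel_def by (intro Inter_lower) simp
  then have "F q = F p" if "q \<in> sharp_class C m p" for q
    using that by (auto simp: sharp_class_def E_def)
  moreover have "p \<in> sharp_class C m p"
    using p by (auto simp: sharp_class_def sharp_rel_def equiv_def refl_on_def)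
  ultimately show ?thesis
    by (intro the_elem_image)
qed

lemma sharp_cellE:
  assumes "P \<in> cells (sharp C) m"
  obtains n c h where "c \<in> cells C n" "h \<in> stream_hom (dcube m) (dcube n)"
    "(n, c, h) \<in> sharp_triples C m" "P = sharp_class C m (n, c, h)"
  using assms by (auto simp: sharp_def sharp_class_def sharp_triples_iff elim!: quotientE)

lemma act_sharp_class:
  assumes C: "cubical_set C" and f: "box l m f" and p: "(n, c, h) \<in> sharp_triples C m"
  shows "act (sharp C) l m f (sharp_class C m (n, c, h)) =
    sharp_class C l (n, c, compose (pts (dcube l)) h (box_real l m f))"
proof -
  have "the_elem ((\<lambda>(n, c, h). sharp_class C l (n, c, act (sing (dcube n)) l m f h)) ` sharp_class C m (n, c, h)) =
    (\<lambda>(n, c, h). sharp_class C l (n, c, act (sing (dcube n)) l m f h)) (n, c, h)"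
  proof (rule the_elem_sharp_class[OF C _ p], unfold prod.case)
    fix k n' f' c h assume f': "box k n' f'" "c \<in> cells C n'" "h \<in> stream_hom (dcube m) (dcube k)"
    have "compose (pts (dcube l)) h (box_real l m f) \<in> stream_hom (dcube l) (dcube k)"
      using compose_dcube_hom[OF box_real_stream_hom[OF f] f'(3)] .
    from sharp_class_act[OF f'(1,2) this]
    show "sharp_class C l (k, act C k n' f' c, act (sing (dcube k)) l m f h) =
      sharp_class C l (n', c, act (sing (dcube n')) l m f (sing_map (box_real k n' f') m h))"
      by (simp add: act_sing sing_map_def compose_dcube_assoc[OF box_real_stream_hom[OF f]])
  qed
  then show ?thesis
    by (simp add: sharp_def act_sing)
qed

definition sharp_eval :: "nat \<Rightarrow> (nat \<times> (point \<Rightarrow> 'a) \<times> (point \<Rightarrow> point)) set \<Rightarrow> point \<Rightarrow> 'a" where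
  "sharp_eval m P = the_elem ((\<lambda>(n, c, h). compose (pts (dcube m)) c h) ` P)"

text \<open>The coend identifies \<open>c\<close> precomposed with \<open>f\<close>, paired with
  \<open>h\<close>, with \<open>c\<close> paired with \<open>f\<close> after \<open>h\<close>; that
  evaluation respects this is associativity of composition.\<close>

lemma sharp_eval_class:
  assumes "(n, c, h) \<in> sharp_triples (sing X) m"
  shows "sharp_eval m (sharp_class (sing X) m (n, c, h)) = compose (pts (dcube m)) c h"
proof -
  have "the_elem ((\<lambda>(n, c, h). compose (pts (dcube m)) c h) ` sharp_class (sing X) m (n, c, h)) =
    (\<lambda>(n, c, h). compose (pts (dcube m)) c h) (n, c, h)"
    by (rule the_elem_sharp_class[OF cubical_set_sing _ assms])
      (simp add: act_sing sing_map_def compose_dcube_assoc)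
  then show ?thesis
    by (simp add: sharp_eval_def)
qed

lemma cubical_map_sharp_eval: "cubical_map (sharp (sing X)) (sing X) sharp_eval"
  unfolding cubical_map_def
proof (intro conjI allI impI ballI; (elim conjE)?)
  fix m P assume "P \<in> cells (sharp (sing X)) m"
  then show "sharp_eval m P \<in> cells (sing X) m"
    by (elim sharp_cellE) (simp add: sharp_eval_class cells_sing compose_dcube_hom)
next
  fix l m f P assume f: "box l m f" and "P \<in> cells (sharp (sing X)) m"
  from this(2) obtain n c h where P: "c \<in> cells (sing X) n" "h \<in> stream_hom (dcube m) (dcube n)"
    "(n, c, h) \<in> sharp_triples (sing X) m" "P = sharp_class (sing X) m (n, c, h)"
    by (rule sharp_cellE)
  have "(n, c, compose (pts (dcube l)) h (box_real l m f)) \<in> sharp_triples (sing X) l"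
    using P(1,2) compose_dcube_hom[OF box_real_stream_hom[OF f]] by (simp add: sharp_triples_iff)
  then show "sharp_eval l (act (sharp (sing X)) l m f P) = act (sing X) l m f (sharp_eval m P)"
    unfolding P(4) act_sharp_class[OF cubical_set_sing f P(3)]
    by (simp add: sharp_eval_class P(3) act_sing compose_dcube_assoc box_real_stream_hom[OF f])
qed

lemma sharp_eval_natural:
  assumes g: "g \<in> stream_hom X Y" and P: "P \<in> cells (sharp (sing X)) m"
  shows "sharp_eval m (sharp_map (sing Y) (sing_map g) m P) = sing_map g m (sharp_eval m P)"
proof -
  obtain n c h where P: "c \<in> cells (sing X) n" "h \<in> stream_hom (dcube m) (dcube n)"
    "(n, c, h) \<in> sharp_triples (sing X) m" "P = sharp_class (sing X) m (n, c, h)"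
    using P by (rule sharp_cellE)
  note cub = cubical_map_sing_map[OF g, unfolded cubical_map_def]
  have "the_elem ((\<lambda>(n, c, h). sharp_class (sing Y) m (n, sing_map g n c, h)) ` sharp_class (sing X) m (n, c, h)) =
    (\<lambda>(n, c, h). sharp_class (sing Y) m (n, sing_map g n c, h)) (n, c, h)"
  proof (rule the_elem_sharp_class[OF cubical_set_sing _ P(3)], unfold prod.case)
    fix k n f c h assume *: "box k n f" "c \<in> cells (sing X) n" "h \<in> stream_hom (dcube m) (dcube k)"
    then show "sharp_class (sing Y) m (k, sing_map g k (act (sing X) k n f c), h) =
      sharp_class (sing Y) m (n, sing_map g n c, sing_map (box_real k n f) m h)"
      using cub by (simp add: sharp_class_act)
  qed
  then have "sharp_map (sing Y) (sing_map g) m P = sharp_class (sing Y) m (n, sing_map g n c, h)"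
    by (simp add: sharp_map_def P(4))
  moreover have "(n, sing_map g n c, h) \<in> sharp_triples (sing Y) m"
    using P(1,2) cub by (simp add: sharp_triples_iff)
  ultimately show ?thesis
    using stream_hom_pts[OF P(2)] P(3)
    by (simp add: P(4) sharp_eval_class sing_map_def compose_def cong: restrict_cong)
qed

lemma sharp_eval_eta:
  assumes "c \<in> cells (sing X) n"
  shows "sharp_eval n (eta (sing X) n c) = c"
proof -
  have "(n, c, box_real n n (box_id n)) \<in> sharp_triples (sing X) n"
    using assms box_real_stream_hom[OF box_ident] by (simp add: sharp_triples_iff)
  then have "sharp_eval n (eta (sing X) n c) = act (sing X) n n (box_id n) c"
    by (simp add: eta_def sharp_eval_class act_sing)
  then show ?thesis
    using assms cubical_set_sing[of X] by (simp add: cubical_set_def)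
qed

text \<open>The coend relation composes on the target side of \<open>h\<close> and
  \<open>phi_sharp_cube\<close> on its source side, so the two operations commute and
  representatives may be used.\<close>

lemma phi_sharp_class:
  assumes C: "cubical_set C" and p: "(n, c, h) \<in> sharp_triples C m" and a: "a \<in> cells (sd2_cube m) k"
  shows "phi_sharp C m (sharp_class C m (n, c, h)) k a =
    sharp_class C k (n, c, compose (pts (dcube k)) h (half_affine k m a))"
proof -
  define F where "F = (\<lambda>(n, c, h). ex2_map (\<lambda>k s. sharp_class C k (n, c, s)) m (phi_sharp_cube m h))"
  have "the_elem (F ` sharp_class C m (n, c, h)) = F (n, c, h)"
  proof (rule the_elem_sharp_class[OF C _ p])
    fix k n f c h assume *: "box k n f" "c \<in> cells C n" "h \<in> stream_hom (dcube m) (dcube k)"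
    have "sharp_class C l (k, act C k n f c, phi_sharp_cube m h l a) =
      sharp_class C l (n, c, phi_sharp_cube m (sing_map (box_real k n f) m h) l a)"
      if a: "a \<in> cells (sd2_cube m) l" for l a
    proof -
      have "compose (pts (dcube l)) h (half_affine l m a) \<in> stream_hom (dcube l) (dcube k)"
        using compose_dcube_hom[OF half_affine_stream_hom[OF a] *(3)] .
      from sharp_class_act[OF *(1,2) this] show ?thesis
        by (simp add: phi_sharp_cube_eq[OF a] sing_map_def compose_dcube_assoc[OF half_affine_stream_hom[OF a]])
    qed
    then show "F (k, act C k n f c, h) = F (n, c, sing_map (box_real k n f) m h)"
      by (simp add: F_def ex2_map_def cong: restrict_cong)
  qed
  then show ?thesis
    using a by (simp add: phi_sharp_def F_def ex2_map_def phi_sharp_cube_eq)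
qed


section \<open>Gluing the cells of a subdivided cube\<close>

definition subcube :: "nat \<Rightarrow> vertex \<Rightarrow> point set" where
  "subcube n w = (\<Pi>\<^sub>E i\<in>{..<n}. {real (w i) / 2..(real (w i) + 1) / 2})"

text \<open>On \<open>subcube n w\<close> this inverts the affine map of the cell
  \<open>subcell n w\<close>.\<close>

definition zoom :: "nat \<Rightarrow> vertex \<Rightarrow> point \<Rightarrow> point" where
  "zoom n w t = (\<lambda>i\<in>{..<n}. 2 * t i - real (w i))"

text \<open>A coordinate \<open>1 / 2\<close> lies in two subcubes and the upper one is chosen;
  agreement of the cells on overlaps makes the glued value independent of the choice.\<close>

definition corner :: "nat \<Rightarrow> point \<Rightarrow> vertex" where
  "corner n t = (\<lambda>i\<in>{..<n}. if 1 / 2 \<le> t i then 1 else 0)"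

definition glue_cells :: "nat \<Rightarrow> (nat \<Rightarrow> (vertex \<Rightarrow> vertex) \<Rightarrow> point \<Rightarrow> 'a) \<Rightarrow> point \<Rightarrow> 'a" where
  "glue_cells n F = (\<lambda>t\<in>pts (dcube n). F n (subcell n (corner n t)) (zoom n (corner n t) t))"

lemma corner_grid: "corner n t \<in> grid 1 n"
  by (simp add: corner_def grid_iff)

lemma pts_subcube_corner: "t \<in> pts (dcube n) \<Longrightarrow> t \<in> subcube n (corner n t)"
  by (auto simp: subcube_def corner_def pts_dcube PiE_iff)

lemma subcube_pts:
  assumes "w \<in> grid 1 n" "t \<in> subcube n w"
  shows "t \<in> pts (dcube n)"
proof -
  have "t i \<in> {0..1}" if "i < n" for i
  proof -
    have "real (w i) \<le> 1" "real (w i) / 2 \<le> t i" "t i \<le> (real (w i) + 1) / 2"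
      using assms that by (simp_all add: grid_iff subcube_def PiE_iff)
    then show ?thesis
      by simp
  qed
  then show ?thesis
    using assms(2) by (simp add: subcube_def pts_dcube PiE_iff)
qed

lemma zoom_pts: "t \<in> subcube n w \<Longrightarrow> zoom n w t \<in> pts (dcube n)"
  by (auto simp: subcube_def zoom_def pts_dcube PiE_iff field_simps)

lemma half_affine_subcell:
  assumes w: "w \<in> grid 1 n" and s: "s \<in> pts (dcube n)"
  shows "half_affine n n (subcell n w) s = (\<lambda>i\<in>{..<n}. (s i + real (w i)) / 2)"
proof (rule extensionalityI[of _ "{..<n}"])
  show "half_affine n n (subcell n w) s \<in> extensional {..<n}"
    unfolding half_affine_def by (rule affine_ext_extensional[OF s])
  fix i assume "i \<in> {..<n}"
  then have i: "i < n"
    by simp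
  have "coord_affine n (\<lambda>x. real (subcell n w x i) / 2) i (real (w i) / 2) (1 / 2)"
    using i by (simp add: coord_affine_def subcell_def add_divide_distrib)
  then show "half_affine n n (subcell n w) s i = (\<lambda>i\<in>{..<n}. (s i + real (w i)) / 2) i"
    using affine_ext_eq[OF s i, of "\<lambda>x j. real (subcell n w x j) / 2"] i
    by (simp add: half_affine_def add_divide_distrib)
qed simp

lemma cubical_homD:
  assumes "F \<in> cubical_hom (sd2_cube n) (sing X)"
  shows "a \<in> cells (sd2_cube n) k \<Longrightarrow> F k a \<in> stream_hom (dcube k) X"
    and "box m k f \<Longrightarrow> a \<in> cells (sd2_cube n) k \<Longrightarrow>
      F m (compose (grid 1 m) a f) = compose (pts (dcube m)) (F k a) (box_real m k f)"
  using assms by (auto simp: cubical_hom_def cubical_map_def cells_sing act_sing lattice_cset_def)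

text \<open>
  On the overlap of two subcubes the differing coordinates equal \<open>1/2\<close>; freezing them in both cells
  gives the same cell.
\<close>

lemma cells_agree:
  assumes F: "F \<in> cubical_hom (sd2_cube n) (sing X)"
    and w: "w \<in> grid 1 n" "w' \<in> grid 1 n" and t: "t \<in> subcube n w" "t \<in> subcube n w'"
  shows "F n (subcell n w) (zoom n w t) = F n (subcell n w') (zoom n w' t)"
proof -
  define J where "J = {i. i < n \<and> w i \<noteq> w' i}"
  \<comment> \<open>On the overlap the zoomed point already has the coordinates that
    \<open>reset\<close> would write, so the realized reset fixes it, and naturality of
    \<open>F\<close> replaces the cell by its frozen version.\<close>
  have freeze: "F n (subcell n u) (zoom n u t) = F n (compose (grid 1 n) (subcell n u) (reset n J u')) (zoom n u t)"
    if u: "u \<in> grid 1 n" "u' \<in> grid 1 n" "t \<in> subcube n u" "t \<in> subcube n u'" "\<And>j. j \<in> J \<Longrightarrow> u j \<noteq> u' j"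
    for u u'
  proof -
    have b: "box n n (reset n J u')"
      using u(2) by (intro box_reset) (auto simp: J_def grid_iff)
    have z: "zoom n u t \<in> pts (dcube n)"
      using zoom_pts[OF u(3)] .
    have "box_real n n (reset n J u') (zoom n u t) = zoom n u t"
    proof (rule extensionalityI[of _ "{..<n}"])
      show "box_real n n (reset n J u') (zoom n u t) \<in> extensional {..<n}"
        using box_real_pts[OF b z] by (simp add: pts_dcube PiE_iff)
      fix j assume "j \<in> {..<n}"
      then have j: "j < n"
        by simp
      show "box_real n n (reset n J u') (zoom n u t) j = zoom n u t j"
      proof (cases "j \<in> J")
        case True
        have "u j \<le> 1" "u' j \<le> 1" "u j \<noteq> u' j"
          using u j True by (auto simp: grid_iff)
        moreover have "real (u j) / 2 \<le> t j" "t j \<le> (real (u j) + 1) / 2"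
          "real (u' j) / 2 \<le> t j" "t j \<le> (real (u' j) + 1) / 2"
          using u(3,4) j by (simp_all add: subcube_def PiE_iff)
        \<comment> \<open>Here \<open>t j = 1 / 2\<close>: the zoomed coordinate is 1 if
          \<open>u j = 0\<close> and 0 if \<open>u j = 1\<close>, in both cases
          \<open>u' j\<close>.\<close>
        ultimately have "zoom n u t j = real (u' j)"
          using j by (auto simp: zoom_def le_Suc_eq)
        moreover have "box_real n n (reset n J u') (zoom n u t) j = real (u' j)"
          using True j by (intro box_real_constant[OF z]) (simp_all add: reset_def)
        ultimately show ?thesis
          by simp
      next
        case False
        then show ?thesis
          using j by (intro box_real_coordinate[OF z]) (simp_all add: reset_def)
      qed
    qed (simp add: zoom_def)
    then show ?thesis
      unfolding cubical_homD(2)[OF F b subcell_cell[OF u(1)]] using z by (simp add: compose_def)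
  qed
  have "reset n J u x \<in> grid 1 n" if "x \<in> grid 1 n" "u \<in> grid 1 n" for u x
    using that by (auto simp: reset_def grid_iff)
  \<comment> \<open>On \<open>J\<close> both composites have the constant coordinate
    \<open>w j + w' j\<close>; elsewhere \<open>w\<close> and \<open>w'\<close> coincide.\<close>
  then have eq: "compose (grid 1 n) (subcell n w) (reset n J w') = compose (grid 1 n) (subcell n w') (reset n J w)"
    using w by (auto simp: compose_def subcell_def fun_eq_iff reset_def J_def)
  have b: "box n n (reset n J u)" if "u \<in> grid 1 n" for u
    using that by (intro box_reset) (auto simp: J_def grid_iff)
  define s where "s = F n (compose (grid 1 n) (subcell n w) (reset n J w'))"
  \<comment> \<open>The two zoomed points differ only in coordinates in \<open>J\<close>, which
    \<open>reset\<close> overwrites.\<close>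
  have "s (zoom n w t) = s (zoom n w' t)"
  proof -
    have z: "zoom n w t \<in> pts (dcube n)" "zoom n w' t \<in> pts (dcube n)"
      using zoom_pts t by auto
    have "box_real n n (reset n J w') (zoom n w t) = box_real n n (reset n J w') (zoom n w' t)"
    proof (rule extensionalityI[of _ "{..<n}"])
      show "box_real n n (reset n J w') (zoom n w t) \<in> extensional {..<n}"
        "box_real n n (reset n J w') (zoom n w' t) \<in> extensional {..<n}"
        using z by (auto simp: box_real_def intro!: affine_ext_extensional)
      fix j assume "j \<in> {..<n}"
      then have j: "j < n"
        by simp
      show "box_real n n (reset n J w') (zoom n w t) j = box_real n n (reset n J w') (zoom n w' t) j"
      proof (cases "j \<in> J")
        case True
        then have "reset n J w' x j = w' j" if "x \<in> grid 1 n" for x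
          using j that by (simp add: reset_def)
        then show ?thesis
          using box_real_constant[OF z(1) j, of "reset n J w'"] box_real_constant[OF z(2) j, of "reset n J w'"]
          by simp
      next
        case False
        then have "reset n J w' x j = x j" if "x \<in> grid 1 n" for x
          using j that by (simp add: reset_def)
        moreover have "zoom n w t j = zoom n w' t j"
          using False j by (simp add: zoom_def J_def)
        ultimately show ?thesis
          using box_real_coordinate[OF z(1) j j, of "reset n J w'"] box_real_coordinate[OF z(2) j j, of "reset n J w'"]
          by simp
      qed
    qed
    then show ?thesis
      unfolding s_def cubical_homD(2)[OF F b[OF w(2)] subcell_cell[OF w(1)]]
      using z by (simp add: compose_def)
  qed
  moreover have "F n (subcell n w) (zoom n w t) = s (zoom n w t)"
    unfolding s_def by (rule freeze[OF w t]) (simp add: J_def)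
  moreover have "F n (subcell n w') (zoom n w' t) = s (zoom n w' t)"
    unfolding s_def eq by (rule freeze[OF w(2,1) t(2,1)]) (auto simp: J_def)
  ultimately show ?thesis
    by simp
qed

lemma glue_cells_eq:
  assumes F: "F \<in> cubical_hom (sd2_cube n) (sing X)" and w: "w \<in> grid 1 n" and t: "t \<in> subcube n w"
  shows "glue_cells n F t = F n (subcell n w) (zoom n w t)"
  using subcube_pts[OF w t] cells_agree[OF F corner_grid w pts_subcube_corner t]
  by (simp add: glue_cells_def)

text \<open>The subcubes form a finite closed cover, so continuity on each of them suffices, with
  \<open>cells_agree\<close> on the overlaps.\<close>

lemma continuous_glue_cells:
  assumes F: "F \<in> cubical_hom (sd2_cube n) (sing X)"
  shows "continuous_map (cube_topology n) (space_of X) (glue_cells n F)"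
proof (rule pasting_lemma_closed[where I = "grid 1 n" and T = "subcube n"
      and f = "\<lambda>w t. F n (subcell n w) (zoom n w t)"])
  show "finite (grid 1 n)"
    unfolding grid_def by (intro finite_PiE) simp_all
  show "closedin (cube_topology n) (subcube n w)" if "w \<in> grid 1 n" for w
  proof -
    have "closedin (top_of_set {0..1}) {real (w i) / 2..(real (w i) + 1) / 2}" if "i < n" for i
    proof -
      have "real (w i) \<le> 1"
        using \<open>w \<in> grid 1 n\<close> that by (simp add: grid_iff)
      then show ?thesis
        by (intro closed_subset) auto
    qed
    then show ?thesis
      unfolding subcube_def cube_topology_def closedin_product_topology by simp
  qed
  show "continuous_map (subtopology (cube_topology n) (subcube n w)) (space_of X)
      (\<lambda>t. F n (subcell n w) (zoom n w t))" if w: "w \<in> grid 1 n" for w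
  proof -
    let ?S = "subtopology (cube_topology n) (subcube n w)"
    have "continuous_map ?S (product_topology (\<lambda>i. top_of_set {0..1}) {..<n}) (zoom n w)"
      unfolding continuous_map_componentwise
    proof (intro conjI ballI)
      show "zoom n w ` topspace ?S \<subseteq> extensional {..<n}"
        by (auto simp: zoom_def)
      fix i assume i: "i \<in> {..<n}"
      have "continuous_map (cube_topology n) (top_of_set {0..1}) (\<lambda>t. t i)"
        using i unfolding cube_topology_def by (intro continuous_map_product_projection) auto
      then have "continuous_map ?S euclideanreal (\<lambda>t. t i)"
        using continuous_map_into_fulltopology continuous_map_from_subtopology by blast
      then have "continuous_map ?S euclideanreal (\<lambda>t. 2 * t i - real (w i))"
        by (intro continuous_intros) auto
      then have "continuous_map ?S euclideanreal (\<lambda>t. zoom n w t i)"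
        using i by (simp add: zoom_def)
      moreover have "zoom n w t i \<in> {0..1}" if "t \<in> subcube n w" for t
        using PiE_mem[OF zoom_pts[OF that, unfolded pts_dcube] i] .
      ultimately show "continuous_map ?S (top_of_set {0..1}) (\<lambda>t. zoom n w t i)"
        by (intro continuous_map_into_subtopology) auto
    qed
    then have "continuous_map ?S (cube_topology n) (zoom n w)"
      by (simp add: cube_topology_def)
    moreover have "continuous_map (cube_topology n) (space_of X) (F n (subcell n w))"
      using cubical_homD(1)[OF F subcell_cell[OF w]]
      by (simp add: stream_hom_def stream_map_def space_of_dcube)
    ultimately show ?thesis
      using continuous_map_compose[of ?S "cube_topology n" "zoom n w" "space_of X" "F n (subcell n w)"]
      by (simp add: o_def)
  qed
  show "F n (subcell n w) (zoom n w t) = F n (subcell n w') (zoom n w' t)"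
    if "w \<in> grid 1 n" "w' \<in> grid 1 n" "t \<in> topspace (cube_topology n) \<inter> subcube n w \<inter> subcube n w'" for w w' t
    using cells_agree[OF F that(1,2)] that(3) by simp
  show "\<exists>w. w \<in> grid 1 n \<and> t \<in> subcube n w \<and> glue_cells n F t = F n (subcell n w) (zoom n w t)"
    if "t \<in> topspace (cube_topology n)" for t
  proof -
    have t: "t \<in> pts (dcube n)"
      using that by (simp add: space_of_dcube)
    show ?thesis
      using corner_grid pts_subcube_corner[OF t] glue_cells_eq[OF F corner_grid pts_subcube_corner[OF t]] by blast
  qed
qed

text \<open>Inside one subcube the glued map is a single singular cube in zoomed coordinates. Every
  \<open>s\<close> between the zoomed endpoints is the zoom of \<open>(s + w) / 2\<close>, which
  lies in \<open>{x..y}\<close>, so the zoomed pair is again a generating step over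
  \<open>U\<close>.\<close>

lemma glue_cells_circ:
  assumes F: "F \<in> cubical_hom (sd2_cube n) (sing X)" and w: "w \<in> grid 1 n"
    and xy: "x \<in> subcube n w" "y \<in> subcube n w" "x \<le> y"
    and U: "openin (space_of X) U" "\<And>z. z \<in> {x..y} \<Longrightarrow> glue_cells n F z \<in> U"
  shows "(glue_cells n F x, glue_cells n F y) \<in> circ X U"
proof -
  define G where "G = F n (subcell n w)"
  have G: "stream_map (dcube n) X G"
    using cubical_homD(1)[OF F subcell_cell[OF w]] by (simp add: G_def stream_hom_def)
  have "zoom n w x \<le> zoom n w y"
    using xy(3) by (auto simp: zoom_def le_fun_def)
  moreover have "openin (cube_topology n) {z \<in> pts (dcube n). G z \<in> U}"
    using G U(1) openin_continuous_map_preimage unfolding stream_map_def space_of_dcube by blast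
  moreover have "s \<in> pts (dcube n) \<and> G s \<in> U" if s: "s \<in> {zoom n w x..zoom n w y}" for s
  proof -
    have s_pts: "s \<in> pts (dcube n)"
      using zoom_pts[OF xy(1)] zoom_pts[OF xy(2)] s PiE_order_convex[of "zoom n w x" "{..<n}" "\<lambda>_. {0..1}" "zoom n w y" s]
      by (simp add: pts_dcube PiE_iff)
    define z where "z = (\<lambda>i\<in>{..<n}. (s i + real (w i)) / 2)"
    have "zoom n w z = s"
      using s_pts by (auto simp: zoom_def z_def pts_dcube PiE_iff extensional_def fun_eq_iff field_simps)
    moreover have z: "z \<in> subcube n w"
      using s_pts by (auto simp: subcube_def z_def pts_dcube PiE_iff)
    moreover have "z \<in> {x..y}"
    proof -
      have "x i \<le> z i \<and> z i \<le> y i" for i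
      proof (cases "i < n")
        case True
        have "zoom n w x i \<le> s i" "s i \<le> zoom n w y i"
          using s by (simp_all add: le_fun_def)
        then show ?thesis
          using True by (simp add: zoom_def z_def)
      next
        case False
        then show ?thesis
          using xy by (simp add: z_def subcube_def PiE_iff extensional_def)
      qed
      then show ?thesis
        by (simp add: le_fun_def)
    qed
    ultimately show ?thesis
      using s_pts U(2)[of z] glue_cells_eq[OF F w z] by (simp add: G_def)
  qed
  ultimately have "(zoom n w x, zoom n w y) \<in> circ (dcube n) {z \<in> pts (dcube n). G z \<in> U}"
    by (intro circ_dcubeI) auto
  then show ?thesis
    using G U(1) glue_cells_eq[OF F w xy(1)] glue_cells_eq[OF F w xy(2)]
    by (simp add: stream_map_def G_def)
qed

text \<open>
  A monotone step from \<open>x\<close> to \<open>y\<close> splits at \<open>x\<close> with its coordinates raised towards \<open>1/2\<close> as far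
  as \<open>y\<close> permits, and each half stays in one subcube.
\<close>

lemma glue_cells_stream_hom:
  assumes X: "stream X" and F: "F \<in> cubical_hom (sd2_cube n) (sing X)"
  shows "glue_cells n F \<in> stream_hom (dcube n) X"
proof -
  have "stream_map (dcube n) X (glue_cells n F)"
  proof (rule stream_map_dcubeI[OF X continuous_glue_cells[OF F]])
    fix U x y
    assume U: "openin (space_of X) U" and xy: "x \<in> pts (dcube n)" "y \<in> pts (dcube n)" "x \<le> y"
      and fU: "\<And>z. z \<in> {x..y} \<Longrightarrow> glue_cells n F z \<in> U"
    define z where "z = (\<lambda>i\<in>{..<n}. if 1 / 2 \<le> x i then x i else min (y i) (1 / 2))"
    have bounds: "0 \<le> x i" "y i \<le> 1" "x i \<le> y i" if "i < n" for i
      using xy that by (simp_all add: pts_dcube PiE_iff le_fun_def)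
    have "x i \<le> z i \<and> z i \<le> y i" for i
      using bounds xy by (cases "i < n") (auto simp: z_def pts_dcube PiE_iff extensional_def)
    then have z: "x \<le> z" "z \<le> y"
      by (simp_all add: le_fun_def)
    have "z \<in> pts (dcube n)"
      using bounds by (force simp: z_def pts_dcube PiE_iff)
    moreover have "z \<in> subcube n (corner n x)"
      using bounds by (force simp: subcube_def corner_def z_def PiE_iff)
    \<comment> \<open>If \<open>z i < 1 / 2\<close> then \<open>z i = y i\<close>; otherwise
      \<open>y i \<ge> z i \<ge> 1 / 2\<close>.\<close>
    moreover have "y \<in> subcube n (corner n z)"
      using bounds xy by (force simp: subcube_def corner_def z_def pts_dcube PiE_iff min_def)
    ultimately have "(glue_cells n F x, glue_cells n F z) \<in> circ X U" "(glue_cells n F z, glue_cells n F y) \<in> circ X U"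
      using glue_cells_circ[OF F corner_grid pts_subcube_corner _ _ U] xy z fU by (auto intro: order_trans)
    then show "(glue_cells n F x, glue_cells n F y) \<in> circ X U"
      using trans_circ[OF X] by (auto dest: transD)
  qed
  then show ?thesis
    by (simp add: stream_hom_def glue_cells_def)
qed

section \<open>Naturality of the gluing and the cubcat identity\<close>

lemma sd2_map_subcell:
  assumes f: "box m n f" and w: "w \<in> grid 1 m"
  shows "compose (grid 1 m) (sd2_map m n f) (subcell m w) = compose (grid 1 m) (subcell n (f w)) f"
proof -
  have "sd2_map m n f (subcell m w x) = subcell n (f w) (f x)" if x: "x \<in> grid 1 m" for x
  proof -
    define v where "v = subcell m w x"
    have v: "v \<in> grid 2 m"
      using PiE_mem[OF sd2_cell_maps_grid[OF subcell_cell[OF w]] x] by (simp add: v_def)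
    have fx: "f x \<in> grid 1 n"
      using PiE_mem[OF box_maps_grid[OF f] x] .
    define lo hi where "lo = (\<lambda>i\<in>{..<m}. v i div 2)" and "hi = (\<lambda>i\<in>{..<m}. (v i + 1) div 2)"
    have lo_hi: "lo \<in> grid 1 m" "hi \<in> grid 1 m"
      using v by (auto simp: lo_def hi_def grid_iff)
    \<comment> \<open>The halves \<open>lo\<close> and \<open>hi\<close> add up to
      \<open>x + w\<close>. A projection preserves this sum, and a constant coordinate contributes
      twice its value on both sides.\<close>
    have "f lo j + f hi j = f x j + f w j" if j: "j < n" for j
      using box_coordinate[OF f j]
    proof (elim disjE exE conjE)
      fix i assume i: "i < m" "\<forall>x\<in>grid 1 m. f x j = x i"
      have "lo i + hi i = v i"
        using i(1) by (simp add: lo_def hi_def)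
      then show ?thesis
        using i lo_hi x w by (simp add: v_def subcell_def)
    qed (use lo_hi x w in simp)
    moreover have "sd2_map m n f v = (\<lambda>j\<in>{..<n}. f lo j + f hi j)"
      unfolding sd2_map_def lo_def hi_def using v by simp
    ultimately show ?thesis
      unfolding v_def[symmetric] using fx by (auto simp: subcell_def)
  qed
  then show ?thesis
    by (auto simp: compose_def)
qed

text \<open>Projections commute with both operations coordinatewise, and a constant
  \<open>e \<in> {0, 1}\<close> has corner \<open>e\<close> and zooms to
  \<open>2 * e - e = e\<close>.\<close>

lemma corner_box_real:
  assumes f: "box m n f" and t: "t \<in> pts (dcube m)"
  shows "corner n (box_real m n f t) = f (corner m t)"
    and "zoom n (f (corner m t)) (box_real m n f t) = box_real m n f (zoom m (corner m t) t)"
proof -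
  have z: "zoom m (corner m t) t \<in> pts (dcube m)"
    using zoom_pts[OF pts_subcube_corner[OF t]] .
  have fc: "f (corner m t) \<in> grid 1 n"
    using PiE_mem[OF box_maps_grid[OF f] corner_grid] .
  have *: "corner n (box_real m n f t) j = f (corner m t) j \<and>
    zoom n (f (corner m t)) (box_real m n f t) j = box_real m n f (zoom m (corner m t) t) j" if j: "j < n" for j
    using box_coordinate[OF f j]
  proof (elim disjE exE conjE)
    fix e :: nat assume e: "e \<le> 1" "\<forall>x\<in>grid 1 m. f x j = e"
    then have "box_real m n f s j = real e" if "s \<in> pts (dcube m)" for s
      using box_real_constant[OF that j] by blast
    then show ?thesis
      using e t z j corner_grid[of m t] by (auto simp: corner_def zoom_def le_Suc_eq)
  next
    fix i assume i: "i < m" "\<forall>x\<in>grid 1 m. f x j = x i"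
    then have "box_real m n f s j = s i" if "s \<in> pts (dcube m)" for s
      using box_real_coordinate[OF that j i(1)] by blast
    moreover have "f (corner m t) j = corner m t i"
      using i corner_grid by blast
    ultimately show ?thesis
      using i(1) t z j by (simp add: corner_def zoom_def)
  qed
  show "corner n (box_real m n f t) = f (corner m t)"
    using * by (intro grid_ext[OF corner_grid fc]) simp
  show "zoom n (f (corner m t)) (box_real m n f t) = box_real m n f (zoom m (corner m t) t)"
    using * box_real_pts[OF f z]
    by (intro extensionalityI[of _ "{..<n}"]) (simp_all add: zoom_def pts_dcube PiE_iff)
qed

lemma cubical_map_glue_cells:
  assumes X: "stream X"
  shows "cubical_map (ex2 (sing X)) (sing X) glue_cells"
  unfolding cubical_map_def
proof (intro conjI allI impI ballI; (elim conjE)?)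
  show "glue_cells n F \<in> cells (sing X) n" if "F \<in> cells (ex2 (sing X)) n" for n F
    using that glue_cells_stream_hom[OF X] by (simp add: ex2_def cells_sing)
  fix m n f F assume f: "box m n f" and "F \<in> cells (ex2 (sing X)) n"
  then have F: "F \<in> cubical_hom (sd2_cube n) (sing X)"
    by (simp add: ex2_def)
  show "glue_cells m (act (ex2 (sing X)) m n f F) = act (sing X) m n f (glue_cells n F)"
  proof (rule extensionalityI[of _ "pts (dcube m)"])
    fix t assume t: "t \<in> pts (dcube m)"
    define w where "w = corner m t"
    have w: "w \<in> grid 1 m"
      unfolding w_def by (rule corner_grid)
    have fw: "f w \<in> grid 1 n"
      using PiE_mem[OF box_maps_grid[OF f] w] .
    have z: "zoom m w t \<in> pts (dcube m)"
      unfolding w_def using zoom_pts[OF pts_subcube_corner[OF t]] .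
    have "glue_cells m (act (ex2 (sing X)) m n f F) t =
        F m (compose (grid 1 m) (sd2_map m n f) (subcell m w)) (zoom m w t)"
      using t subcell_cell[OF w] by (simp add: glue_cells_def ex2_def w_def)
    also have "\<dots> = F n (subcell n (f w)) (box_real m n f (zoom m w t))"
      unfolding sd2_map_subcell[OF f w] cubical_homD(2)[OF F f subcell_cell[OF fw]]
      using z by (simp add: compose_def)
    also have "\<dots> = glue_cells n F (box_real m n f t)"
      using corner_box_real[OF f t] box_real_pts[OF f t] by (simp add: glue_cells_def w_def)
    finally show "glue_cells m (act (ex2 (sing X)) m n f F) t = act (sing X) m n f (glue_cells n F) t"
      using t by (simp add: act_sing compose_def)
  qed (simp_all add: glue_cells_def act_sing compose_def)
qed

lemma glue_cells_natural:
  "glue_cells n (ex2_map (sing_map g) n F) = sing_map g n (glue_cells n F)"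
proof -
  have "glue_cells n (ex2_map (sing_map g) n F) t = g (glue_cells n F t)" if t: "t \<in> pts (dcube n)" for t
    using t zoom_pts[OF pts_subcube_corner[OF t]] subcell_cell[OF corner_grid]
    by (simp add: glue_cells_def ex2_map_def sing_map_def compose_def)
  then show ?thesis
    by (auto simp: sing_map_def compose_def fun_eq_iff) (simp add: glue_cells_def)
qed

text \<open>At \<open>t\<close> the glued map reads the cell at \<open>zoom m w t\<close> with
  \<open>w = corner m t\<close>, where \<open>phi_sharp\<close> has inserted the affine map inverse
  to this zoom; both sides become \<open>c (h t)\<close>.\<close>

lemma sharp_eval_phi_sharp:
  assumes P: "P \<in> cells (sharp (sing X)) m"
  shows "glue_cells m (ex2_map sharp_eval m (phi_sharp (sing X) m P)) = sharp_eval m P"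
proof -
  obtain n c h where P: "c \<in> cells (sing X) n" "h \<in> stream_hom (dcube m) (dcube n)"
    "(n, c, h) \<in> sharp_triples (sing X) m" "P = sharp_class (sing X) m (n, c, h)"
    using P by (rule sharp_cellE)
  show ?thesis
  proof (rule extensionalityI[of _ "pts (dcube m)"])
    show "sharp_eval m P \<in> extensional (pts (dcube m))"
      by (simp add: P(4) sharp_eval_class[OF P(3)] compose_def)
    fix t assume t: "t \<in> pts (dcube m)"
    define w where "w = corner m t"
    have a: "subcell m w \<in> cells (sd2_cube m) m"
      unfolding w_def by (rule subcell_cell[OF corner_grid])
    have z: "zoom m w t \<in> pts (dcube m)"
      unfolding w_def using zoom_pts[OF pts_subcube_corner[OF t]] .
    have "compose (pts (dcube m)) h (half_affine m m (subcell m w)) \<in> stream_hom (dcube m) (dcube n)"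
      using compose_dcube_hom[OF half_affine_stream_hom[OF a] P(2)] .
    then have triple: "(n, c, compose (pts (dcube m)) h (half_affine m m (subcell m w))) \<in> sharp_triples (sing X) m"
      using P(1) by (simp add: sharp_triples_iff)
    have "half_affine m m (subcell m w) (zoom m w t) = t"
      unfolding half_affine_subcell[OF corner_grid[of m t, folded w_def] z]
      using t by (auto simp: zoom_def pts_dcube PiE_iff extensional_def fun_eq_iff)
    then have "sharp_eval m (phi_sharp (sing X) m P m (subcell m w)) (zoom m w t) = c (h t)"
      unfolding P(4) phi_sharp_class[OF cubical_set_sing P(3) a] sharp_eval_class[OF triple]
      using z by (simp add: compose_def)
    then show "glue_cells m (ex2_map sharp_eval m (phi_sharp (sing X) m P)) t = sharp_eval m P t"
      using t a by (simp add: glue_cells_def ex2_map_def flip: w_def)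
        (simp add: P(4) sharp_eval_class[OF P(3)] compose_def)
  qed (simp add: glue_cells_def)
qed

theorem proposition5p7:
  fixes \<Gamma> :: "('o, 'm) cat" and X :: "('o, 'm, 'a) stream_diagram"
  assumes "category \<Gamma>" and "gamma_stream \<Gamma> X"
  shows "gamma_cubcat \<Gamma> (gamma_sing X)"
proof -
  have stream: "stream (ob X a)" if "a \<in> Obj \<Gamma>" for a
    using assms(2) that by (simp add: gamma_stream_def ditop_def k_stream_def)
  have ar: "ar X f \<in> stream_hom (ob X (Dom \<Gamma> f)) (ob X (Cod \<Gamma> f))" if "f \<in> Arr \<Gamma>" for f
    using assms(2) that by (simp add: gamma_stream_def)
  have ar_id: "sing_map (ar X (Idn \<Gamma> a)) n c = c" if "a \<in> Obj \<Gamma>" "c \<in> stream_hom (dcube n) (ob X a)" for a n c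
  proof (rule extensionalityI[of _ "pts (dcube n)"])
    show "sing_map (ar X (Idn \<Gamma> a)) n c t = c t" if "t \<in> pts (dcube n)" for t
      using assms(2) \<open>a \<in> Obj \<Gamma>\<close> that stream_hom_pts[OF \<open>c \<in> _\<close>]
      by (simp add: gamma_stream_def sing_map_def compose_def)
  qed (use that in \<open>auto simp: sing_map_def compose_def stream_hom_def\<close>)
  have ar_comp: "sing_map (ar X (Cmp \<Gamma> g f)) n c = sing_map (ar X g) n (sing_map (ar X f) n c)"
    if "g \<in> Arr \<Gamma>" "f \<in> Arr \<Gamma>" "Cod \<Gamma> f = Dom \<Gamma> g" "c \<in> stream_hom (dcube n) (ob X (Dom \<Gamma> f))" for f g n c
    using assms(2) that(1-3) stream_hom_pts[OF that(4)]
    by (auto simp: gamma_stream_def sing_map_def compose_def fun_eq_iff)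
  have "gamma_cubical_set \<Gamma> (gamma_sing X)"
    using cubical_map_sing_map[OF ar] ar_id ar_comp
    by (simp add: gamma_cubical_set_def gamma_sing_def cells_sing cubical_set_sing)
  \<comment> \<open>Both structure maps are given by one formula at all objects of
    \<open>\<Gamma>\<close>, so compatibility with its arrows is naturality in the stream.\<close>
  moreover have "gamma_cubical_map \<Gamma> (gamma_sharp \<Gamma> (gamma_sing X)) (gamma_sing X) (\<lambda>a. sharp_eval)"
    using sharp_eval_natural[OF ar]
    by (simp add: gamma_cubical_map_def gamma_sharp_def gamma_sing_def cubical_map_sharp_eval)
  moreover have "gamma_cubical_map \<Gamma> (gamma_ex2 (gamma_sing X)) (gamma_sing X) (\<lambda>a. glue_cells)"
    using cubical_map_glue_cells[OF stream]
    by (simp add: gamma_cubical_map_def gamma_ex2_def gamma_sing_def glue_cells_natural)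
  ultimately show ?thesis
    unfolding gamma_cubcat_def
    by (intro conjI exI[of _ "\<lambda>a. sharp_eval"] exI[of _ "\<lambda>a. glue_cells"])
      (simp_all add: gamma_sing_def sharp_eval_eta sharp_eval_phi_sharp)
qed

end
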